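(* Let $d\ge 1$ and let $\{\mathcal{M}_t, t\ge 0\}$, $\mathcal{M}_t=\{M^x_t, x\in\mathbb{Z}^d\}$, be the meteor process on $\mathbb{Z}^d$ under the stationary measure $Q_\infty$ (i.e. $\mathcal{M}_0$ has distribution $Q_\infty$). Then $$\mathbb{E}_{Q_\infty} M^x_0 = 1,\qquad x\in\mathbb{Z}^d,$$ $$\operatorname{Var}_{Q_\infty} M^x_0 = 1,\qquad x\in\mathbb{Z}^d,$$ $$\operatorname{Cov}_{Q_\infty}(M^x_0,M^y_0) = -\frac{1}{2d},\qquad x\leftrightarrow y,$$ $$\operatorname{Cov}_{Q_\infty}(M^x_0,M^y_0)=0,\qquad x\ne y \text{ and } x\not\leftrightarrow y.$$
   Context: Meteor process on a connected simple graph with vertex set $V$ and bounded degrees: let $N^v$, $v\in V$, be independent Poisson processes with intensity 1, independent of the initial masses $M^v_0\ge 0$. At each jump time $t$ of $N^v$, the mass at $v$ is distributed equally among the $d_v$ neighbors of $v$: $M^v_t=0$ and $M^x_t=M^x_{t-}+M^v_{t-}/d_v$ for every neighbor $x$ of $v$; the mass at a vertex does not change otherwise. On $\mathbb{Z}^d$ the nearest-neighbor graph structure is used, and $x\leftrightarrow y$ means that $x$ and $y$ are nearest neighbors. Definition of $Q_\infty$: let $\mathcal{C}_k$ be the circular graph with vertex set $\{1,\dots,k\}$ and edges $(j,j+1)$, $1\le j\le k-1$, and $(k,1)$; let $\mathcal{C}_k^d$ be the $d$-dimensional torus (Cartesian product of $d$ copies of $\mathcal{C}_k$). The meteor process on $\mathcal{C}_k^d$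 with total mass $k^d$ (average mass 1 per vertex) has a unique stationary distribution $Q_k$. Identify the vertex set of $\mathcal{C}_k^d$ by translation with $K'_k=\{1,\dots,k\}^d-(\lfloor k/2\rfloor,\dots,\lfloor k/2\rfloor)\subset\mathbb{Z}^d$ and extend configurations to $\mathbb{Z}^d$ $k$-periodically in each coordinate; thus $Q_k$ is viewed as a distribution on $\mathbb{R}^{\mathbb{Z}^d}$ (with the topology of pointwise convergence). $Q_\infty$ is the weak limit of $Q_k$ as $k\to\infty$ (this limit exists, and it is a stationary distribution for the meteor process on $\mathbb{Z}^d$). *)

theory Defs
  imports "HOL-Probability.Probability"
begin

section \<open>Poisson processes\<close>

definition poisson_process :: "'w measure \<Rightarrow> real \<Rightarrow> (real \<Rightarrow> 'w \<Rightarrow> nat) \<Rightarrow> bool" where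
  "poisson_process P rate N \<longleftrightarrow>
     (\<forall>t\<ge>0. N t \<in> measurable P (count_space UNIV)) \<and>
     (AE \<omega> in P. N 0 \<omega> = 0 \<and>
        (\<forall>s t. 0 \<le> s \<longrightarrow> s \<le> t \<longrightarrow> N s \<omega> \<le> N t \<omega>) \<and>
        (\<forall>t\<ge>0. ((\<lambda>s. N s \<omega>) \<longlongrightarrow> N t \<omega>) (at_right t))) \<and>
     (\<forall>s t. 0 \<le> s \<longrightarrow> s < t \<longrightarrow>
        distr P (count_space UNIV) (\<lambda>\<omega>. N t \<omega> - N s \<omega>) = measure_pmf (poisson_pmf (rate * (t - s)))) \<and>
     (\<forall>(n::nat) \<tau>. 0 \<le> \<tau> 0 \<longrightarrow> (\<forall>i<n. \<tau> i \<le> \<tau> (Suc i)) \<longrightarrow>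
        prob_space.indep_vars P (\<lambda>_. count_space UNIV)
          (\<lambda>i \<omega>. N (\<tau> (Suc i)) \<omega> - N (\<tau> i) \<omega>) {..<n})"

text \<open>Jump times of a nondecreasing, right-continuous counting path.\<close>

definition jump_time :: "(real \<Rightarrow> nat) \<Rightarrow> real \<Rightarrow> bool" where
  "jump_time n t \<longleftrightarrow> 0 < t \<and> (\<forall>s. 0 \<le> s \<longrightarrow> s < t \<longrightarrow> n s < n t)"


section \<open>The meteor process on a graph\<close>

text \<open>A graph is given by its vertex set \<^term>\<open>V\<close> and its adjacency relation \<^term>\<open>E\<close>; it
  is used below only for connected simple graphs of bounded degree (tori and the integer lattice).\<close>

definition nbrs :: "'v set \<Rightarrow> ('v \<Rightarrow> 'v \<Rightarrow> bool) \<Rightarrow> 'v \<Rightarrow> 'v set" where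
  "nbrs V E v = {x \<in> V. E v x}"

definition vertex_degree :: "'v set \<Rightarrow> ('v \<Rightarrow> 'v \<Rightarrow> bool) \<Rightarrow> 'v \<Rightarrow> nat" where
  "vertex_degree V E v = card (nbrs V E v)"

text \<open>The evolution of the masses \<^term>\<open>m\<close> along one realization \<^term>\<open>n\<close> of the clocks;
  \<^term>\<open>left_limit m t v\<close> is the mass at \<^term>\<open>v\<close> just before time \<^term>\<open>t\<close>.
  Almost surely no two clocks jump simultaneously, so the two clauses do not conflict.\<close>

definition left_limit :: "(real \<Rightarrow> 'v \<Rightarrow> real) \<Rightarrow> real \<Rightarrow> 'v \<Rightarrow> real" where
  "left_limit m t v = Lim (at_left t) (\<lambda>s. m s v)"

definition meteor_path ::
    "'v set \<Rightarrow> ('v \<Rightarrow> 'v \<Rightarrow> bool) \<Rightarrow> ('v \<Rightarrow> real \<Rightarrow> nat) \<Rightarrow> (real \<Rightarrow> 'v \<Rightarrow> real) \<Rightarrow> bool" where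
  "meteor_path V E n m \<longleftrightarrow>
     (\<forall>v\<in>V. \<forall>t. jump_time (n v) t \<longrightarrow>
        m t v = 0 \<and>
        (\<forall>x\<in>nbrs V E v. m t x = left_limit m t x + left_limit m t v / real (vertex_degree V E v))) \<and>
     (\<forall>x\<in>V. \<forall>s t. 0 \<le> s \<longrightarrow> s < t \<longrightarrow>
        (\<forall>u\<in>{s<..t}. \<forall>v\<in>insert x (nbrs V E x). \<not> jump_time (n v) u) \<longrightarrow> m t x = m s x)"

definition meteor_process ::
    "'w measure \<Rightarrow> 'v set \<Rightarrow> ('v \<Rightarrow> 'v \<Rightarrow> bool) \<Rightarrow> ('v \<Rightarrow> real \<Rightarrow> 'w \<Rightarrow> nat) \<Rightarrow>
      (real \<Rightarrow> 'v \<Rightarrow> 'w \<Rightarrow> real) \<Rightarrow> bool" where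
  "meteor_process P V E N M \<longleftrightarrow>
     prob_space P \<and>
     (\<forall>v\<in>V. poisson_process P 1 (N v)) \<and>
     prob_space.indep_vars P (\<lambda>_. PiM {0..} (\<lambda>_. count_space UNIV))
       (\<lambda>v \<omega>. \<lambda>t\<in>{0..}. N v t \<omega>) V \<and>
     (\<forall>t\<ge>0. \<forall>v\<in>V. M t v \<in> borel_measurable P) \<and>
     prob_space.indep_set P
       (sets (vimage_algebra (space P) (\<lambda>\<omega>. \<lambda>v\<in>V. M 0 v \<omega>) (PiM V (\<lambda>_. borel))))
       (sets (vimage_algebra (space P) (\<lambda>\<omega>. \<lambda>v\<in>V. \<lambda>t\<in>{0..}. N v t \<omega>)
          (PiM V (\<lambda>_. PiM {0..} (\<lambda>_. count_space UNIV))))) \<and>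
     (AE \<omega> in P. (\<forall>v\<in>V. 0 \<le> M 0 v \<omega>) \<and>
        meteor_path V E (\<lambda>v t. N v t \<omega>) (\<lambda>t v. M t v \<omega>))"

definition law_at :: "'w measure \<Rightarrow> 'v set \<Rightarrow> (real \<Rightarrow> 'v \<Rightarrow> 'w \<Rightarrow> real) \<Rightarrow> real \<Rightarrow> ('v \<Rightarrow> real) measure" where
  "law_at P V M t = distr P (PiM V (\<lambda>_. borel)) (\<lambda>\<omega>. \<lambda>v\<in>V. M t v \<omega>)"

text \<open>The sample space has to be given a type here. Pairs of an initial configuration and a
  family of clock paths suffice: they determine the process almost surely.\<close>

definition stationary_distribution ::
    "'v set \<Rightarrow> ('v \<Rightarrow> 'v \<Rightarrow> bool) \<Rightarrow> ('v \<Rightarrow> real) measure \<Rightarrow> bool" where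
  "stationary_distribution V E Q \<longleftrightarrow>
     (\<exists>(P :: (('v \<Rightarrow> real) \<times> ('v \<Rightarrow> real \<Rightarrow> nat)) measure) N M.
        meteor_process P V E N M \<and> (\<forall>t\<ge>0. law_at P V M t = Q))"


section \<open>The integer lattice and the discrete tori\<close>

text \<open>The dimension \<open>d\<close> is \<^term>\<open>CARD('d)\<close>; it is at least 1.\<close>

definition lattice_adj :: "int ^ 'd \<Rightarrow> int ^ 'd \<Rightarrow> bool" where
  "lattice_adj x y \<longleftrightarrow> (\<Sum>i\<in>UNIV. \<bar>x $ i - y $ i\<bar>) = 1"

definition circle_edge :: "nat \<Rightarrow> int \<Rightarrow> int \<Rightarrow> bool" where
  "circle_edge k a b \<longleftrightarrow> (1 \<le> a \<and> a \<le> int k - 1 \<and> b = a + 1) \<or> (a = int k \<and> b = 1)"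

definition torus :: "nat \<Rightarrow> (int ^ 'd) set" where
  "torus k = {x. \<forall>i. x $ i \<in> {1..int k}}"

definition torus_adj :: "nat \<Rightarrow> int ^ 'd \<Rightarrow> int ^ 'd \<Rightarrow> bool" where
  "torus_adj k x y \<longleftrightarrow> x \<in> torus k \<and> y \<in> torus k \<and>
     (\<exists>i. (circle_edge k (x $ i) (y $ i) \<or> circle_edge k (y $ i) (x $ i)) \<and>
          (\<forall>j. j \<noteq> i \<longrightarrow> x $ j = y $ j))"

definition torus_stationary :: "nat \<Rightarrow> (int ^ 'd \<Rightarrow> real) measure \<Rightarrow> bool" where
  "torus_stationary k Q \<longleftrightarrow>
     stationary_distribution (torus k) (torus_adj k) Q \<and>
     (AE m in Q. (\<Sum>v\<in>torus k. m v) = real k ^ CARD('d))"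

text \<open>The vertex \<open>j\<close> of the torus is placed at the lattice point with coordinates
  \<open>j i - k div 2\<close>, and the configuration is repeated with period \<open>k\<close> in every coordinate.\<close>

definition torus_vertex :: "nat \<Rightarrow> int ^ 'd \<Rightarrow> int ^ 'd" where
  "torus_vertex k x = (\<chi> i. (x $ i + int (k div 2) - 1) mod int k + 1)"

definition periodic_extension :: "nat \<Rightarrow> (int ^ 'd \<Rightarrow> real) \<Rightarrow> (int ^ 'd \<Rightarrow> real)" where
  "periodic_extension k m = (\<lambda>x. m (torus_vertex k x))"


section \<open>The limiting distribution\<close>

text \<open>Weak convergence of Borel probability measures. On the function space
  \<^typ>\<open>int ^ 'd \<Rightarrow> real\<close> the library topology is that of pointwise convergence.\<close>

definition converges_weakly ::
    "(nat \<Rightarrow> 'a::topological_space measure) \<Rightarrow> 'a measure \<Rightarrow> bool" where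
  "converges_weakly \<mu> \<nu> \<longleftrightarrow> sets \<nu> = sets borel \<and> prob_space \<nu> \<and>
     (\<forall>f :: 'a \<Rightarrow> real. continuous_on UNIV f \<longrightarrow> bounded (range f) \<longrightarrow>
        (\<lambda>k. \<integral>x. f x \<partial>\<mu> k) \<longlonglongrightarrow> (\<integral>x. f x \<partial>\<nu>))"

text \<open>For \<open>k < 3\<close> the circular graph is not simple; these terms do not affect the limit.\<close>

definition is_Q_infinity :: "(int ^ 'd \<Rightarrow> real) measure \<Rightarrow> bool" where
  "is_Q_infinity Q \<longleftrightarrow>
     (\<exists>Qk. (\<forall>k\<ge>3. torus_stationary k (Qk k)) \<and>
           converges_weakly (\<lambda>k. distr (Qk k) borel (periodic_extension k)) Q)"

definition (in prob_space) covariance :: "('a \<Rightarrow> real) \<Rightarrow> ('a \<Rightarrow> real) \<Rightarrow> real" where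
  "covariance X Y = expectation (\<lambda>\<omega>. (X \<omega> - expectation X) * (Y \<omega> - expectation Y))"

end

theory Submission
  imports Defs
begin

text \<open>
  The second moments of a stationary law are determined by a closed system of equations. A ring at \<open>v\<close> replaces the
  configuration \<open>m\<close> by \<open>m + m v * lap v\<close>, where \<open>lap v\<close> is the graph Laplacian applied to the point
  mass at \<open>v\<close>; it is linear in \<open>m\<close>, so under a stationary law the second moments
  \<open>c x y = E (m x * m y)\<close> satisfy a linear system, called balance below. On a regular graph
  \<open>1 - lap x y\<close> solves it, because the rows of the Laplacian sum to zero. This function equals 2 on
  the diagonal, \<open>1 - 1/D\<close> on edges and 1 elsewhere, which are exactly the second moments claimed.

  On a finite torus the system determines \<open>c\<close> up to a factor: a nonnegative solution with a zero
  vanishes identically (\<open>balanced_zero_propagates\<close>), and this applies to the difference of \<open>c\<close> from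
  the smallest multiple of \<open>1 - lap\<close> above it. The total mass fixes the factor, so the moments of
  \<open>Q\<^sub>k\<close> are already the limiting ones (\<open>finite_stationary_moments\<close>). Balance itself comes from the
  infinitesimal generator, obtained by letting a short time interval shrink
  (\<open>stationary_generator\<close>).

  Weak convergence does not by itself carry second moments to the limit, since part of them could
  escape to infinity. It gives mean 1, second moments at most \<open>1 - lap\<close> (Fatou), and, by truncation,
  the balance equations on the lattice for the limit. The lost part \<open>e = (1 - lap) - c\<close> is thus a
  nonnegative bounded solution. If the supremum \<open>S\<close> of its ratio to \<open>1 - lap\<close> were positive, then
  near a point where \<open>S\<close> is almost attained the ratio would be almost \<open>S\<close> on all pairs \<open>B \<times> B'\<close> for
  two long segments \<open>B, B'\<close> with \<open>n\<close> points. But the masses of \<open>B\<close> and \<open>B'\<close> have mean \<open>n\<close> and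
  variance at most \<open>n\<close>, so the expectation of their product is at least \<open>n\<^sup>2 - n\<close>, and \<open>e\<close> sums to at
  most \<open>2 * n\<close> over \<open>B \<times> B'\<close>. Hence \<open>S = 0\<close> (\<open>lattice_balanced_unique\<close>) and nothing is lost.
\<close>


section \<open>The balance equations for second moments on a regular graph\<close>

text \<open>For a graph of degree \<open>D\<close> this is the kernel of \<open>P - I\<close>, where \<open>P\<close> is the transition operator
  of simple random walk. A ring at \<open>v\<close> adds \<open>lap E D v\<close> times the mass of \<open>v\<close> to the configuration.\<close>

definition lap :: "('v \<Rightarrow> 'v \<Rightarrow> bool) \<Rightarrow> nat \<Rightarrow> 'v \<Rightarrow> 'v \<Rightarrow> real" where
  "lap E D v x = (if x = v then -1 else if E v x then 1 / real D else 0)"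

locale regular_graph =
  fixes V :: "'v set" and E :: "'v \<Rightarrow> 'v \<Rightarrow> bool" and D :: nat
  assumes sym: "E x y \<Longrightarrow> E y x"
    and irrefl: "\<not> E x x"
    and edge_in: "E x y \<Longrightarrow> y \<in> V"
    and finite_nbrs: "finite (nbrs V E x)"
    and card_nbrs: "x \<in> V \<Longrightarrow> card (nbrs V E x) = D"
    and degree_ge_2: "D \<ge> 2"
begin

definition star :: "'v \<Rightarrow> 'v set" where
  "star x = insert x (nbrs V E x)"

definition stationary_moment :: "'v \<Rightarrow> 'v \<Rightarrow> real" where
  "stationary_moment x y = 1 - lap E D x y"

text \<open>With \<open>c x y = m x * m y\<close>, this is the change of \<open>m x * m y\<close> caused by a ring at \<open>v\<close>
  (\<open>hit_product_diff\<close>); for second moments \<open>c\<close> it is the expectation of that change.\<close>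

definition drift :: "('v \<Rightarrow> 'v \<Rightarrow> real) \<Rightarrow> 'v \<Rightarrow> 'v \<Rightarrow> 'v \<Rightarrow> real" where
  "drift c x y v = lap E D v x * c v y + lap E D v y * c x v + lap E D v x * lap E D v y * c v v"

text \<open>All clocks have rate 1, so balance says that the expected products have zero time derivative.
  Rings outside the two stars change neither coordinate, which keeps the sum finite on the lattice.\<close>

definition balanced :: "('v \<Rightarrow> 'v \<Rightarrow> real) \<Rightarrow> bool" where
  "balanced c \<longleftrightarrow> (\<forall>x\<in>V. \<forall>y\<in>V. (\<Sum>v\<in>star x \<union> star y. drift c x y v) = 0)"

lemma in_nbrs_iff: "v \<in> nbrs V E x \<longleftrightarrow> E x v"
  using edge_in by (auto simp: nbrs_def)

lemma finite_star [simp]: "finite (star x)"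
  using finite_nbrs by (simp add: star_def)

lemma lap_sym: "lap E D x y = lap E D y x"
  using sym by (auto simp: lap_def)

lemma lap_eq_0: "v \<notin> star x \<Longrightarrow> lap E D v x = 0"
  using sym by (auto simp: lap_def star_def in_nbrs_iff)

lemma sum_lap:
  assumes "finite F" "star x \<subseteq> F"
  shows "(\<Sum>v\<in>F. lap E D v x * f v) = (\<Sum>v\<in>nbrs V E x. f v) / real D - f x"
proof -
  have "(\<Sum>v\<in>F. lap E D v x * f v) = (\<Sum>v\<in>star x. lap E D v x * f v)"
    using assms lap_eq_0 by (intro sum.mono_neutral_right) auto
  also have "\<dots> = - f x + (\<Sum>v\<in>nbrs V E x. lap E D v x * f v)"
    unfolding star_def using finite_nbrs irrefl by (subst sum.insert) (auto simp: in_nbrs_iff lap_def)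
  also have "(\<Sum>v\<in>nbrs V E x. lap E D v x * f v) = (\<Sum>v\<in>nbrs V E x. f v / real D)"
    using sym irrefl by (intro sum.cong) (auto simp: in_nbrs_iff lap_def)
  finally show ?thesis by (simp add: sum_divide_distrib)
qed

lemma sum_drift_superset:
  assumes "finite F" "star x \<union> star y \<subseteq> F"
  shows "(\<Sum>v\<in>F. drift c x y v) = (\<Sum>v\<in>star x \<union> star y. drift c x y v)"
  using assms lap_eq_0 by (intro sum.mono_neutral_right) (auto simp: drift_def)

text \<open>The terms with \<open>c v v\<close> are grouped with the moves of the first coordinate. If \<open>x \<noteq> y\<close> are adjacent,
  then \<open>lap y y = -1\<close> makes the summand at \<open>v = y\<close> vanish and the term \<open>lap x y * c x x\<close> cancels the
  summand \<open>v = x\<close> of the second sum, so every surviving coefficient is nonnegative: this is the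
  generator of two tagged particles that jump together only when they share a vertex.\<close>

lemma sum_drift:
  "(\<Sum>v\<in>star x \<union> star y. drift c x y v) =
     (\<Sum>v\<in>nbrs V E x. c v y + lap E D v y * c v v) / real D
   + (\<Sum>v\<in>nbrs V E y. c x v) / real D - lap E D x y * c x x - 2 * c x y"
proof -
  let ?F = "star x \<union> star y"
  have "(\<Sum>v\<in>?F. drift c x y v) =
      (\<Sum>v\<in>?F. lap E D v x * (c v y + lap E D v y * c v v)) + (\<Sum>v\<in>?F. lap E D v y * c x v)"
    by (simp add: drift_def sum.distrib[symmetric] algebra_simps)
  then show ?thesis
    by (simp add: sum_lap)
qed

lemma stationary_moment_bounds: "1/2 \<le> stationary_moment x y" "stationary_moment x y \<le> 1 + of_bool (x = y)"
proof -
  have "1 / real D \<le> 1/2" using degree_ge_2 by (simp add: divide_simps)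
  then show "1/2 \<le> stationary_moment x y" "stationary_moment x y \<le> 1 + of_bool (x = y)"
    by (auto simp: stationary_moment_def lap_def)
qed

lemma sum_stationary_moment:
  assumes "finite F" "star x \<subseteq> F" "x \<in> V"
  shows "(\<Sum>v\<in>F. stationary_moment v x) = real (card F)"
  using sum_lap[OF assms(1,2), of "\<lambda>_. 1"] card_nbrs[OF assms(3)] degree_ge_2
  by (simp add: stationary_moment_def sum_subtractf)

text \<open>Inserting \<open>1 - lap\<close>, the three quadratic terms in \<open>lap\<close> cancel because \<open>c v v = 2\<close>, and what is
  left are sums of \<open>lap\<close> over a full star, which are zero.\<close>

lemma balanced_stationary_moment: "balanced stationary_moment"
  unfolding balanced_def
proof safe
  fix x y assume xy: "x \<in> V" "y \<in> V"
  let ?F = "star x \<union> star y"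
  have 0: "(\<Sum>v\<in>?F. lap E D v x) = 0" "(\<Sum>v\<in>?F. lap E D v y) = 0"
    using sum_lap[of ?F _ "\<lambda>_. 1"] card_nbrs xy degree_ge_2 by simp_all
  have "(\<Sum>v\<in>?F. drift stationary_moment x y v) = (\<Sum>v\<in>?F. lap E D v x + lap E D v y)"
  proof (rule sum.cong[OF refl])
    fix v
    have "lap E D v v = -1" by (simp add: lap_def)
    then show "drift stationary_moment x y v = lap E D v x + lap E D v y"
      unfolding drift_def stationary_moment_def lap_sym[of x v] by (simp add: algebra_simps)
  qed
  with 0 show "(\<Sum>v\<in>?F. drift stationary_moment x y v) = 0" by (simp add: sum.distrib)
qed

lemma balanced_diff_scaled:
  assumes "balanced c" "balanced c'"
  shows "balanced (\<lambda>x y. S * c x y - c' x y)"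
proof -
  have "drift (\<lambda>x y. S * c x y - c' x y) x y v = S * drift c x y v - drift c' x y v" for x y v
    by (simp add: drift_def algebra_simps)
  then show ?thesis
    using assms by (simp add: balanced_def sum_subtractf sum_distrib_left[symmetric])
qed

context
  fixes g :: "'v \<Rightarrow> 'v \<Rightarrow> real"
  assumes bal: "balanced g" and nonneg: "\<forall>x\<in>V. \<forall>y\<in>V. 0 \<le> g x y"
begin

text \<open>A quantitative minimum principle: by \<open>sum_drift\<close> a nonnegative balanced function at \<open>(x, y)\<close>
  dominates a fixed fraction of its value at each pair from which two tagged particles can move to
  \<open>(x, y)\<close>. A pair of distinct vertices is never reached from the diagonal by moving one particle,
  hence the restriction on \<open>u\<close>; the second bound is for simultaneous jumps from \<open>(u, u)\<close>.\<close>

lemma balanced_nonneg_bounds: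
  assumes x: "x \<in> V" and y: "y \<in> V" and u: "E x u"
  shows "u \<noteq> y \<or> x = y \<Longrightarrow> g u y \<le> 2 * real D * g x y"
    and "E y u \<Longrightarrow> g u u \<le> 2 * (real D)\<^sup>2 * g x y"
proof -
  let ?D = "real D"
  define a where "a v = g v y + lap E D v y * g v v" for v
  have D: "?D > 0" using degree_ge_2 by simp
  have eq: "2 * g x y = (\<Sum>v\<in>nbrs V E x. a v) / ?D + (\<Sum>v\<in>nbrs V E y. g x v) / ?D - lap E D x y * g x x"
    using bal[unfolded balanced_def] x y by (simp add: sum_drift a_def)
  have uV: "u \<in> V" and uN: "u \<in> nbrs V E x" using u edge_in in_nbrs_iff by auto
  have a_ge: "a v \<ge> 0 \<and> (v \<noteq> y \<longrightarrow> g v y \<le> a v \<and> lap E D v y * g v v \<le> a v)" if "v \<in> V" for v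
  proof -
    have "0 \<le> g v y" "0 \<le> g v v" using that y nonneg by auto
    then show ?thesis by (auto simp: a_def lap_def)
  qed
  then have a_u: "a u \<le> (\<Sum>v\<in>nbrs V E x. a v)"
    using uN finite_nbrs by (intro member_le_sum) (auto simp: nbrs_def)
  have main: "a u \<le> 2 * ?D * g x y"
  proof (cases "x = y")
    \<comment> \<open>On the diagonal \<open>lap x x = -1\<close> moves one \<open>g x x\<close> to the left-hand side.\<close>
    case True
    have "0 \<le> (\<Sum>v\<in>nbrs V E y. g x v)"
      using x nonneg by (intro sum_nonneg) (auto simp: nbrs_def)
    with eq True have "g x y \<ge> (\<Sum>v\<in>nbrs V E x. a v) / ?D"
      using D by (auto simp: lap_def)
    then have "(\<Sum>v\<in>nbrs V E x. a v) \<le> ?D * g x y"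
      using D by (simp add: field_simps)
    moreover have "0 \<le> ?D * g x y" using D nonneg x y by simp
    ultimately show ?thesis using a_u by linarith
  next
    case False
    have "?D * lap E D x y * g x x \<le> (\<Sum>v\<in>nbrs V E y. g x v)"
    proof (cases "E x y")
      case True
      have "g x x \<le> (\<Sum>v\<in>nbrs V E y. g x v)"
        using sym[OF True] x nonneg finite_nbrs
        by (intro member_le_sum[where f = "g x"]) (auto simp: in_nbrs_iff edge_in)
      with True False D show ?thesis by (simp add: lap_def)
    next
      case F: False
      with False show ?thesis 
        using x nonneg by (auto simp: lap_def nbrs_def intro!: sum_nonneg)
    qed
    with eq D have "(\<Sum>v\<in>nbrs V E x. a v) \<le> 2 * ?D * g x y"
      by (simp add: field_simps)
    then show ?thesis using a_u by linarith
  qed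
  show "g u y \<le> 2 * ?D * g x y" if "u \<noteq> y \<or> x = y"
    using that main a_ge[OF uV] u irrefl by (cases "u = y") force+
  show "g u u \<le> 2 * ?D\<^sup>2 * g x y" if "E y u"
  proof -
    have "lap E D u y = 1 / ?D" "u \<noteq> y" using that sym irrefl by (auto simp: lap_def)
    then have "g u u / ?D \<le> 2 * ?D * g x y" using a_ge[OF uV] main by auto
    then show ?thesis using D by (simp add: field_simps power2_eq_square)
  qed
qed

end

text \<open>The strong minimum principle. The zero is first carried to the diagonal: walk the first coordinate
  towards \<open>y0\<close>, and from a pair of neighbours \<open>(w, y0)\<close> step aside to another neighbour \<open>u\<close> of
  \<open>w\<close>, which exists as the degree is at least two; then \<open>w\<close> is adjacent to both \<open>u\<close> and \<open>y0\<close>. The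
  zero then spreads along the diagonal, and from the diagonal to all pairs.\<close>

lemma balanced_zero_propagates:
  assumes bal: "balanced g" and nonneg: "\<forall>x\<in>V. \<forall>y\<in>V. 0 \<le> g x y"
    and symm: "\<And>x y. g x y = g y x"
    and conn: "\<And>x y. x \<in> V \<Longrightarrow> y \<in> V \<Longrightarrow> E\<^sup>*\<^sup>* x y"
    and x0: "x0 \<in> V" and y0: "y0 \<in> V" and z0: "g x0 y0 = 0"
    and x: "x \<in> V" and y: "y \<in> V"
  shows "g x y = 0"
proof -
  note bounds = balanced_nonneg_bounds[OF bal nonneg]
  have move: "g u y = 0" if "g x y = 0" "x \<in> V" "y \<in> V" "E x u" "u \<noteq> y \<or> x = y" for x y u
  proof -
    have "0 \<le> g u y" using nonneg edge_in[OF that(4)] that(3) by blast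
    then show ?thesis using bounds(1)[OF that(2-5)] that(1) by simp
  qed
  have diag: "g u u = 0" if "g x y = 0" "x \<in> V" "y \<in> V" "E x u" "E y u" for x y u
  proof -
    have "0 \<le> g u u" using nonneg edge_in[OF that(4)] by blast
    then show ?thesis using bounds(2)[OF that(2-5)] that(1) by simp
  qed
  have "\<exists>z\<in>V. g z z = 0" if "E\<^sup>*\<^sup>* w y0" "w \<in> V" "g w y0 = 0" for w
    using that
  proof (induction rule: converse_rtranclp_induct)
    case base
    then show ?case by auto
  next
    case (step w v)
    show ?case
    proof (cases "v = y0")
      case True
      have "\<exists>u. E w u \<and> u \<noteq> y0"
      proof (rule ccontr)
        assume "\<not> ?thesis"
        then have "nbrs V E w \<subseteq> {y0}" by (auto simp: in_nbrs_iff)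
        from card_mono[OF _ this] show False using card_nbrs[OF step.prems(1)] degree_ge_2 by simp
      qed
      then obtain u where u: "E w u" "u \<noteq> y0" by auto
      then have "g u y0 = 0" using move step.prems y0 by auto
      then have "g w w = 0" using diag[of u y0 w] u edge_in step.hyps sym True y0 by blast
      then show ?thesis using step.prems by auto
    next
      case False
      then have "g v y0 = 0" using move step.prems step.hyps y0 by auto
      then show ?thesis using step.IH step.hyps edge_in by auto
    qed
  qed
  from this[OF conn[OF x0 y0] x0 z0] obtain z where z: "z \<in> V" "g z z = 0" by auto
  have "g y y = 0"
    using conn[OF z(1) y]
  proof (induction rule: rtranclp_induct)
    case base
    then show ?case using z by auto
  next
    case (step u v)
    then show ?case using diag[of u u v] edge_in sym by blast
  qed
  show "g x y = 0"
    using conn[OF y x]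
  proof (induction rule: rtranclp_induct)
    case base
    then show ?case using \<open>g y y = 0\<close> by auto
  next
    case (step u v)
    then have "u \<in> V" using edge_in sym by blast
    then show ?case using move[OF step.IH _ y step.hyps(2)] \<open>g y y = 0\<close> by (cases "v = y") auto
  qed
qed

text \<open>The largest ratio \<open>S\<close> of \<open>c\<close> to the explicit solution is attained, so the difference
  \<open>S * stationary_moment - c\<close> is nonnegative with a zero. Both kernels have the same total sum, whence
  \<open>S = 1\<close>.\<close>

lemma balanced_eq_stationary_moment:
  assumes fin: "finite V" and bal: "balanced c" and symm: "\<And>x y. c x y = c y x"
    and conn: "\<And>x y. x \<in> V \<Longrightarrow> y \<in> V \<Longrightarrow> E\<^sup>*\<^sup>* x y"
    and total: "(\<Sum>x\<in>V. \<Sum>y\<in>V. c x y) = (real (card V))\<^sup>2"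
    and x: "x \<in> V" and y: "y \<in> V"
  shows "c x y = stationary_moment x y"
proof -
  define h where "h p = c (fst p) (snd p) / stationary_moment (fst p) (snd p)" for p
  define S where "S = Max (h ` (V \<times> V))"
  have pos: "stationary_moment u v > 0" for u v using stationary_moment_bounds(1)[of u v] by linarith
  have ne: "finite (h ` (V \<times> V))" "h ` (V \<times> V) \<noteq> {}" using fin x by auto
  have "S \<in> h ` (V \<times> V)" unfolding S_def using ne by (rule Max_in)
  then obtain x0 y0 where 0: "x0 \<in> V" "y0 \<in> V" "S = h (x0, y0)" by auto
  define g where "g u v = S * stationary_moment u v - c u v" for u v
  have "g u v = 0" if "u \<in> V" "v \<in> V" for u v
  proof (rule balanced_zero_propagates[of g x0 y0])
    show "balanced g"
      unfolding g_def by (intro balanced_diff_scaled balanced_stationary_moment bal)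
    show "\<forall>u\<in>V. \<forall>v\<in>V. 0 \<le> g u v"
    proof safe
      fix u v assume that: "u \<in> V" "v \<in> V"
      have "h (u, v) \<le> S" unfolding S_def using ne that by auto
      then show "0 \<le> g u v" using pos[of u v] by (simp add: g_def h_def field_simps)
    qed
    show "g u v = g v u" for u v using symm by (simp add: g_def stationary_moment_def lap_sym)
    show "g x0 y0 = 0" using 0 pos[of x0 y0] by (simp add: g_def h_def)
  qed (use 0 that conn in auto)
  then have c: "c u v = S * stationary_moment u v" if "u \<in> V" "v \<in> V" for u v
    using that by (simp add: g_def)
  have "star v \<subseteq> V" if "v \<in> V" for v
    using that by (auto simp: star_def in_nbrs_iff edge_in)
  then have "(\<Sum>u\<in>V. stationary_moment v u) = real (card V)" if "v \<in> V" for v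
    using sum_stationary_moment[OF fin] that by (simp add: stationary_moment_def lap_sym[of v])
  then have "(real (card V))\<^sup>2 = S * (real (card V))\<^sup>2"
    using total by (simp add: c sum_distrib_left[symmetric] power2_eq_square)
  then have "S = 1" using x fin by auto
  then show ?thesis using c x y by simp
qed

end

section \<open>Infinitesimal stationarity of the meteor process\<close>

definition hit :: "('v \<Rightarrow> 'v \<Rightarrow> bool) \<Rightarrow> nat \<Rightarrow> 'v \<Rightarrow> ('v \<Rightarrow> real) \<Rightarrow> 'v \<Rightarrow> real" where
  "hit E D v m = (\<lambda>x. m x + m v * lap E D v x)"

definition counting_path :: "(real \<Rightarrow> nat) \<Rightarrow> bool" where
  "counting_path n \<longleftrightarrow> n 0 = 0 \<and> (\<forall>s t. 0 \<le> s \<longrightarrow> s \<le> t \<longrightarrow> n s \<le> n t) \<and>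
     (\<forall>t\<ge>0. (n \<longlongrightarrow> n t) (at_right t))"

lemma counting_path_mono: "counting_path n \<Longrightarrow> 0 \<le> s \<Longrightarrow> s \<le> t \<Longrightarrow> n s \<le> n t"
  by (simp add: counting_path_def)

lemma no_jump_time:
  assumes "counting_path n" "n t = 0" "u \<le> t"
  shows "\<not> jump_time n u"
proof
  assume j: "jump_time n u"
  then have "0 < u" "n 0 < n u" by (auto simp: jump_time_def)
  with counting_path_mono[OF assms(1), of u t] assms show False by simp
qed

text \<open>The jump time is the first time at which the count is positive; right-continuity ensures that the
  infimum is attained.\<close>

lemma single_jump_time:
  assumes n: "counting_path n" and t: "0 < t" and one: "n t = 1"
  obtains u where "0 < u" "u \<le> t" "\<And>s. s \<le> t \<Longrightarrow> jump_time n s \<longleftrightarrow> s = u"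
proof -
  define A where "A = {s. 0 \<le> s \<and> s \<le> t \<and> 1 \<le> n s}"
  define u where "u = Inf A"
  have tA: "t \<in> A" using t one by (simp add: A_def)
  have bdd: "bdd_below A" by (rule bdd_belowI[of _ 0]) (simp add: A_def)
  have u0: "0 \<le> u" unfolding u_def using tA by (intro cInf_greatest) (auto simp: A_def)
  have ut: "u \<le> t" unfolding u_def using tA bdd by (rule cInf_lower)
  have before: "n s = 0" if "0 \<le> s" "s < u" for s
  proof (rule ccontr)
    assume "n s \<noteq> 0"
    then have "s \<in> A" using that ut by (simp add: A_def)
    from cInf_lower[OF this bdd] that show False by (simp add: u_def)
  qed
  have nu: "n u = 1"
  proof (rule ccontr)
    assume "n u \<noteq> 1"
    with counting_path_mono[OF n u0 ut] one have nu0: "n u = 0" by simp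
    have "(n \<longlongrightarrow> n u) (at_right u)" using n u0 by (simp add: counting_path_def)
    then have "eventually (\<lambda>s. n s = n u) (at_right u)" by (rule tendsto_discrete[THEN iffD1])
    then obtain b where b: "u < b" "\<And>s. u < s \<Longrightarrow> s < b \<Longrightarrow> n s = 0"
      unfolding eventually_at_right_field using nu0 by auto
    have "b \<le> s" if "s \<in> A" for s
    proof (rule ccontr)
      assume "\<not> b \<le> s"
      then have "n s = 0" using b before[of s] nu0 that by (cases s u rule: linorder_cases) (auto simp: A_def)
      then show False using that by (simp add: A_def)
    qed
    then have "b \<le> u" unfolding u_def using tA by (intro cInf_greatest) auto
    with b show False by simp
  qed
  have "u \<noteq> 0" using n nu by (auto simp: counting_path_def)
  with u0 have "0 < u" by simp
  moreover have "jump_time n s \<longleftrightarrow> s = u" if s: "s \<le> t" for s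
  proof
    assume j: "jump_time n s"
    then have s0: "0 < s" "n 0 < n s" by (auto simp: jump_time_def)
    then have "\<not> s < u" using before[of s] by auto
    moreover have "\<not> u < s"
    proof
      assume "u < s"
      then have "n u < n s" using j u0 by (auto simp: jump_time_def)
      then show False using counting_path_mono[OF n _ s] s0 one nu by simp
    qed
    ultimately show "s = u" by simp
  next
    assume "s = u"
    then show "jump_time n s" using before nu \<open>0 < u\<close> by (simp add: jump_time_def)
  qed
  ultimately show ?thesis using ut that by blast
qed

context regular_graph
begin

lemma meteor_path_no_ring:
  assumes path: "meteor_path V E n m" and n: "\<And>v. v \<in> V \<Longrightarrow> counting_path (n v)"
    and t: "0 < t" and zero: "\<And>w. w \<in> V \<Longrightarrow> n w t = 0" and x: "x \<in> V"
  shows "m t x = m 0 x"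
proof -
  have "\<forall>u\<in>{0<..t}. \<forall>v\<in>insert x (nbrs V E x). \<not> jump_time (n v) u"
    using no_jump_time[OF n zero] x by (auto simp: nbrs_def)
  then show ?thesis using path t x by (auto simp: meteor_path_def)
qed

text \<open>Before the jump time \<open>u\<close> nothing moves, so the left limits at \<open>u\<close> are the initial masses, and after
  \<open>u\<close> nothing moves until \<open>t\<close>.\<close>

lemma meteor_path_one_ring:
  assumes path: "meteor_path V E n m" and n: "\<And>v. v \<in> V \<Longrightarrow> counting_path (n v)"
    and t: "0 < t" and v: "v \<in> V" and one: "\<And>w. w \<in> V \<Longrightarrow> n w t = (if w = v then 1 else 0)"
    and x: "x \<in> V"
  shows "m t x = hit E D v (m 0) x"
proof -
  obtain u where u: "0 < u" "u \<le> t" "\<And>s. s \<le> t \<Longrightarrow> jump_time (n v) s \<longleftrightarrow> s = u"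
    using single_jump_time[OF n[OF v] t] one[OF v] by auto
  have jump: "jump_time (n w) s \<longleftrightarrow> w = v \<and> s = u" if "w \<in> V" "s \<le> t" for w s
    using no_jump_time[OF n, of w t s] one[of w] u(3) that by (cases "w = v") auto
  have const: "m r y = m s y"
    if "0 \<le> s" "s < r" "r \<le> t" "y \<in> V" "r < u \<or> u \<le> s \<or> v \<notin> insert y (nbrs V E y)" for r s y
  proof -
    have "\<forall>z\<in>{s<..r}. \<forall>w\<in>insert y (nbrs V E y). \<not> jump_time (n w) z"
    proof (intro ballI notI)
      fix z w assume z: "z \<in> {s<..r}" and w: "w \<in> insert y (nbrs V E y)" and j: "jump_time (n w) z"
      have "w \<in> V" using w that by (auto simp: nbrs_def)
      then show False using jump[of w z] j z w that by auto
    qed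
    then show ?thesis using path that unfolding meteor_path_def by blast
  qed
  have left: "left_limit m u y = m 0 y" if "y \<in> V" for y
  proof -
    have "eventually (\<lambda>s. m s y = m 0 y) (at_left u)"
      using u by (intro eventually_at_leftI[of 0]) (auto intro!: const that)
    then have "((\<lambda>s. m s y) \<longlongrightarrow> m 0 y) (at_left u)"
      by (rule tendsto_eventually)
    then show ?thesis unfolding left_limit_def by (intro tendsto_Lim) auto
  qed
  have ju: "jump_time (n v) u" using jump v u by simp
  have deg: "vertex_degree V E v = D" using card_nbrs[OF v] by (simp add: vertex_degree_def)
  have at_v: "m u v = 0" using path v ju unfolding meteor_path_def by blast
  have at_nbr: "m u y = m 0 y + m 0 v / real D" if "y \<in> nbrs V E v" for y
  proof -
    have "m u y = left_limit m u y + left_limit m u v / real (vertex_degree V E v)"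
      using path v ju that unfolding meteor_path_def by blast
    then show ?thesis using left v that deg by (simp add: nbrs_def)
  qed
  have "m u x = hit E D v (m 0) x"
  proof (cases "x = v \<or> E v x")
    case True
    then show ?thesis using at_v at_nbr[of x] irrefl by (auto simp: hit_def lap_def in_nbrs_iff)
  next
    case False
    then have "m u x = m 0 x" using u x sym by (intro const) (auto simp: in_nbrs_iff)
    with False show ?thesis by (simp add: hit_def lap_def)
  qed
  moreover have "m t x = m u x"
    using const[of u t x] u x by (cases "u = t") auto
  ultimately show ?thesis by simp
qed

end

lemma poisson_process_counting_path:
  assumes "poisson_process P rate N"
  shows "AE \<omega> in P. counting_path (\<lambda>t. N t \<omega>)"
  using assms unfolding poisson_process_def counting_path_def by blast

lemma poisson_process_prob:
  assumes P: "prob_space P" and N: "poisson_process P rate N" and t: "0 < t"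
  shows "Sigma_Algebra.measure P {\<omega>\<in>space P. N t \<omega> = j} = pmf (poisson_pmf (rate * t)) j"
proof -
  interpret prob_space P by fact
  have meas [measurable]: "N t \<in> measurable P (count_space UNIV)" "N 0 \<in> measurable P (count_space UNIV)"
    using N t by (auto simp: poisson_process_def)
  have d: "distr P (count_space UNIV) (\<lambda>\<omega>. N t \<omega> - N 0 \<omega>) = measure_pmf (poisson_pmf (rate * t))"
  proof -
    have "\<forall>s t. 0 \<le> s \<longrightarrow> s < t \<longrightarrow>
        distr P (count_space UNIV) (\<lambda>\<omega>. N t \<omega> - N s \<omega>) = measure_pmf (poisson_pmf (rate * (t - s)))"
      using N unfolding poisson_process_def by blast
    from this[rule_format, of 0 t] t show ?thesis by simp
  qed
  have "AE \<omega> in P. N 0 \<omega> = 0"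
    using poisson_process_counting_path[OF N] by eventually_elim (simp add: counting_path_def)
  then have "prob {\<omega>\<in>space P. N t \<omega> = j} = prob {\<omega>\<in>space P. N t \<omega> - N 0 \<omega> = j}"
    by (intro finite_measure_eq_AE) auto
  also have "\<dots> = Sigma_Algebra.measure (distr P (count_space UNIV) (\<lambda>\<omega>. N t \<omega> - N 0 \<omega>)) {j}"
    by (subst measure_distr) (auto intro!: arg_cong[where f = prob])
  also have "\<dots> = pmf (poisson_pmf (rate * t)) j"
    by (simp add: d measure_pmf_single)
  finally show ?thesis .
qed

lemma independent_clocks_prob:
  assumes P: "prob_space P" and N: "\<And>v. v \<in> V \<Longrightarrow> poisson_process P 1 (N v)"
    and ind: "prob_space.indep_vars P (\<lambda>_. PiM {0..} (\<lambda>_. count_space UNIV))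
       (\<lambda>v \<omega>. \<lambda>t\<in>{0..}. N v t \<omega>) V"
    and V: "finite V" and t: "0 < t"
  shows "Sigma_Algebra.measure P {\<omega>\<in>space P. \<forall>v\<in>V. N v t \<omega> = j v} = (\<Prod>v\<in>V. pmf (poisson_pmf t) (j v))"
proof -
  interpret prob_space P by fact
  have "indep_vars (\<lambda>_. count_space UNIV) (\<lambda>v \<omega>. (\<lambda>t\<in>{0..}. N v t \<omega>) t) V"
    by (rule indep_vars_compose2[OF ind]) (use t in auto)
  then have ind': "indep_vars (\<lambda>_. count_space UNIV) (\<lambda>v \<omega>. N v t \<omega>) V"
    using t by simp
  show ?thesis
  proof (cases "V = {}")
    case True
    then show ?thesis by (simp add: prob_space)
  next
    case False
    have "{\<omega>\<in>space P. \<forall>v\<in>V. N v t \<omega> = j v} = (\<Inter>v\<in>V. N v t -` {j v} \<inter> space P)"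
      using False by auto
    also have "prob \<dots> = (\<Prod>v\<in>V. prob (N v t -` {j v} \<inter> space P))"
      using False V by (intro indep_varsD[OF ind']) auto
    also have "\<dots> = (\<Prod>v\<in>V. pmf (poisson_pmf t) (j v))"
    proof (rule prod.cong[OF refl])
      fix v assume "v \<in> V"
      have "N v t -` {j v} \<inter> space P = {\<omega>\<in>space P. N v t \<omega> = j v}" by auto
      then show "prob (N v t -` {j v} \<inter> space P) = pmf (poisson_pmf t) (j v)"
        using poisson_process_prob[OF P N[OF \<open>v \<in> V\<close>] t] by simp
    qed
    finally show ?thesis .
  qed
qed

text \<open>Independence of \<open>X\<close> from a \<open>\<sigma>\<close>-algebra is inherited by the real random variables \<open>g X\<close> and the
  indicator of \<open>A\<close>, for which expectations multiply.\<close>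

lemma (in prob_space) indep_set_expectation:
  assumes ind: "indep_set (sets (vimage_algebra (space M) X S)) B" and X: "X \<in> measurable M S"
    and g: "g \<in> borel_measurable S" and bdd: "\<And>x. \<bar>g x\<bar> \<le> (K::real)" and A: "A \<in> B"
  shows "expectation (\<lambda>\<omega>. indicator A \<omega> * g (X \<omega>)) = prob A * (\<integral>x. g x \<partial>distr M S X)"
proof -
  have ev: "A \<in> events" using indep_setD_ev2[OF ind] A by auto
  have gX [measurable]: "random_variable borel (\<lambda>\<omega>. g (X \<omega>))"
    using measurable_comp[OF X g] by (simp add: comp_def)
  have iv: "indep_var borel (\<lambda>\<omega>. g (X \<omega>)) borel (indicator A :: 'a \<Rightarrow> real)"
    unfolding indep_var_eq
  proof safe
    show "random_variable borel (\<lambda>\<omega>. g (X \<omega>))" by (rule gX)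
    show "random_variable borel (indicator A :: 'a \<Rightarrow> real)" using ev by measurable
    have "sigma_sets (space M) {(\<lambda>\<omega>. g (X \<omega>)) -` C \<inter> space M |C. C \<in> sets borel}
        \<subseteq> sigma_sets (space M) {X -` C \<inter> space M |C. C \<in> sets S}"
    proof (intro sigma_sets_mono subsetI, elim CollectE exE conjE)
      fix D and C :: "real set" assume C: "C \<in> sets borel" and D: "D = (\<lambda>\<omega>. g (X \<omega>)) -` C \<inter> space M"
      have "D = X -` (g -` C \<inter> space S) \<inter> space M"
        using measurable_space[OF X] by (auto simp: D)
      then show "D \<in> sigma_sets (space M) {X -` C \<inter> space M |C. C \<in> sets S}"
        using measurable_sets[OF g C]
        by (intro sigma_sets.Basic CollectI exI[of _ "g -` C \<inter> space S"] conjI)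
    qed
    moreover have "sigma_sets (space M) {(indicator A :: 'a \<Rightarrow> real) -` C \<inter> space M |C. C \<in> sets borel}
        \<subseteq> sigma_sets (space M) {A}"
    proof (intro sigma_sets_mono subsetI, elim CollectE exE conjE)
      fix D and C :: "real set"
      assume C: "C \<in> sets borel" and D: "D = (indicator A :: 'a \<Rightarrow> real) -` C \<inter> space M"
      let ?S = "sigma (space M) {A}"
      have sub: "{A} \<subseteq> Pow (space M)" using sets.sets_into_space[OF ev] by simp
      have "A \<in> sets ?S" using sub by simp
      then have "(indicator A :: 'a \<Rightarrow> real) \<in> borel_measurable ?S" by measurable
      from measurable_sets[OF this C] show "D \<in> sigma_sets (space M) {A}"
        using sub by (simp add: D)
    qed
    moreover have "indep_set (sigma_sets (space M) {X -` C \<inter> space M |C. C \<in> sets S}) (sigma_sets (space M) {A})"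
    proof -
      have "indep_set (sigma_sets (space M) (sigma_sets (space M) {X -` C \<inter> space M |C. C \<in> sets S}))
          (sigma_sets (space M) {A})"
      proof (rule indep_set_sigma_sets)
        show "indep_set (sigma_sets (space M) {X -` C \<inter> space M |C. C \<in> sets S}) {A}"
          using ind A unfolding indep_sets2_eq sets_vimage_algebra by blast
        have "Int_stable (sets (vimage_algebra (space M) X S))"
          by (rule sets.Int_stable)
        then show "Int_stable (sigma_sets (space M) {X -` C \<inter> space M |C. C \<in> sets S})"
          unfolding sets_vimage_algebra .
      qed (auto simp: Int_stable_def)
      then show ?thesis
        by (subst (asm) sigma_sets_sigma_sets_eq) auto
    qed
    ultimately show "indep_set (sigma_sets (space M) {(\<lambda>\<omega>. g (X \<omega>)) -` C \<inter> space M |C. C \<in> sets borel})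
       (sigma_sets (space M) {(indicator A :: 'a \<Rightarrow> real) -` C \<inter> space M |C. C \<in> sets borel})"
      unfolding indep_sets2_eq by blast
  qed
  have int: "integrable M (\<lambda>\<omega>. g (X \<omega>))"
    using X g bdd by (intro integrable_const_bound[where B = K]) auto
  have "expectation (\<lambda>\<omega>. g (X \<omega>) * indicator A \<omega>) = expectation (\<lambda>\<omega>. g (X \<omega>)) * expectation (indicator A)"
  proof (rule indep_var_lebesgue_integral[OF iv int])
    show "integrable M (indicator A :: 'a \<Rightarrow> real)"
      using ev by (intro integrable_real_indicator) (auto simp: emeasure_eq_measure)
  qed
  also have "expectation (indicator A) = prob A" using ev by simp
  also have "expectation (\<lambda>\<omega>. g (X \<omega>)) = (\<integral>x. g x \<partial>distr M S X)"
    using X g by (simp add: integral_distr)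
  finally show ?thesis by (simp add: mult.commute)
qed

text \<open>In a short time \<open>t\<close>, with \<open>n\<close> clocks, no clock rings with probability \<open>exp (- n t)\<close>, exactly the
  clock of \<open>v\<close> rings, once, with probability \<open>t exp (- n t)\<close>, and the remaining probability is
  \<open>O (t\<^sup>2)\<close>. Since the expectation of \<open>f\<close> does not change, \<open>t exp (- n t)\<close> times the claimed sum is
  \<open>O (t\<^sup>2)\<close>, by the independence of the clocks from the initial masses.\<close>

lemma (in regular_graph) stationary_generator:
  fixes f :: "('v \<Rightarrow> real) \<Rightarrow> real"
  assumes V: "finite V" and stat: "stationary_distribution V E Q"
    and f: "f \<in> borel_measurable (PiM V (\<lambda>_. borel))" and bdd: "\<And>m. \<bar>f m\<bar> \<le> K"
  shows "(\<Sum>v\<in>V. \<integral>m. f (restrict (hit E D v m) V) - f m \<partial>Q) = 0"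
proof -
  let ?B = "PiM V (\<lambda>_. borel :: real measure)"
  obtain P :: "(('v \<Rightarrow> real) \<times> ('v \<Rightarrow> real \<Rightarrow> nat)) measure" and N M
    where proc: "meteor_process P V E N M" and law: "\<And>t. 0 \<le> t \<Longrightarrow> law_at P V M t = Q"
    using stat unfolding stationary_distribution_def by blast
  have P: "prob_space P" and pois: "\<And>v. v \<in> V \<Longrightarrow> poisson_process P 1 (N v)"
    and indN: "prob_space.indep_vars P (\<lambda>_. PiM {0..} (\<lambda>_. count_space UNIV)) (\<lambda>v \<omega>. \<lambda>t\<in>{0..}. N v t \<omega>) V"
    and M: "\<And>t v. 0 \<le> t \<Longrightarrow> v \<in> V \<Longrightarrow> M t v \<in> borel_measurable P"
    and indMN: "prob_space.indep_set P
       (sets (vimage_algebra (space P) (\<lambda>\<omega>. \<lambda>v\<in>V. M 0 v \<omega>) ?B))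
       (sets (vimage_algebra (space P) (\<lambda>\<omega>. \<lambda>v\<in>V. \<lambda>t\<in>{0..}. N v t \<omega>)
          (PiM V (\<lambda>_. PiM {0..} (\<lambda>_. count_space UNIV)))))"
    and path: "AE \<omega> in P. meteor_path V E (\<lambda>v t. N v t \<omega>) (\<lambda>t v. M t v \<omega>)"
    using proc unfolding meteor_process_def by auto
  interpret prob_space P by fact
  define X where "X t \<omega> = (\<lambda>v\<in>V. M t v \<omega>)" for t \<omega>
  have X: "X t \<in> measurable P ?B" if "0 \<le> t" for t
    unfolding X_def using M[OF that] by (intro measurable_restrict)
  have X0: "(\<lambda>\<omega>. \<lambda>v\<in>V. M 0 v \<omega>) = X 0" by (simp add: fun_eq_iff X_def)
  have lawX: "distr P ?B (X t) = Q" if "0 \<le> t" for t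
    using law[OF that] by (simp add: law_at_def X_def[abs_def])
  define g where "g v m = f (restrict (hit E D v m) V) - f m" for v m
  have g: "g v \<in> borel_measurable ?B" if "v \<in> V" for v
  proof -
    have "(\<lambda>m. restrict (hit E D v m) V) \<in> measurable ?B ?B"
      unfolding hit_def using that by (intro measurable_restrict) measurable
    from measurable_comp[OF this f] show ?thesis
      unfolding g_def comp_def using f by measurable
  qed
  have gK: "\<bar>g v m\<bar> \<le> 2 * K" for v m
    using bdd[of m] bdd[of "restrict (hit E D v m) V"] by (simp add: g_def)
  have K: "0 \<le> K" using bdd[of undefined] by simp
  define R where "R = (\<Sum>v\<in>V. \<integral>m. g v m \<partial>Q)"
  let ?n = "real (card V)"
  have bound: "\<bar>R\<bar> \<le> 2 * K * ?n\<^sup>2 * t" if t: "0 < t" and nt: "?n * t \<le> 1" for t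
  proof -
    define C where "C j = {\<omega>\<in>space P. \<forall>w\<in>V. N w t \<omega> = j w}" for j
    \<comment> \<open>\<open>A v\<close>: only the clock of \<open>v\<close> rings, exactly once; \<open>A0\<close>: none rings.\<close>
    define A where "A v = C (\<lambda>w. if w = v then 1 else 0)" for v
    define A0 where "A0 = C (\<lambda>_. 0)"
    have C_in: "C j \<in> sets (vimage_algebra (space P) (\<lambda>\<omega>. \<lambda>v\<in>V. \<lambda>t\<in>{0..}. N v t \<omega>)
          (PiM V (\<lambda>_. PiM {0..} (\<lambda>_. count_space UNIV))))" for j
    proof -
      let ?S = "PiM V (\<lambda>_. PiM {0..} (\<lambda>_. count_space (UNIV :: nat set))) :: ('v \<Rightarrow> real \<Rightarrow> nat) measure"
      have m: "(\<lambda>n. n w t) \<in> measurable ?S (count_space UNIV)" if "w \<in> V" for w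
      proof -
        have "(\<lambda>n. n w) \<in> measurable ?S (PiM {0..} (\<lambda>_. count_space (UNIV :: nat set)))"
          using that by measurable
        moreover have "(\<lambda>p. p t) \<in> measurable (PiM {0..} (\<lambda>_. count_space (UNIV :: nat set))) (count_space UNIV)"
          using t by (intro measurable_component_singleton) auto
        ultimately show ?thesis by (rule measurable_compose)
      qed
      have "{n \<in> space ?S. \<forall>w\<in>V. n w t = j w} \<in> sets ?S"
      proof (rule sets.sets_Collect_finite_All[OF _ V])
        fix w assume "w \<in> V"
        have "(\<lambda>n. n w t) -` {j w} \<inter> space ?S \<in> sets ?S"
          using m[OF \<open>w \<in> V\<close>] by (rule measurable_sets) simp
        also have "(\<lambda>n. n w t) -` {j w} \<inter> space ?S = {n \<in> space ?S. n w t = j w}" by auto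
        finally show "{n \<in> space ?S. n w t = j w} \<in> sets ?S" .
      qed
      from in_vimage_algebra[OF this, of "\<lambda>\<omega>. \<lambda>v\<in>V. \<lambda>t\<in>{0..}. N v t \<omega>" "space P"]
      show ?thesis
      proof (rule back_subst[where P = "\<lambda>Z. Z \<in> _"])
        show "(\<lambda>\<omega>. \<lambda>v\<in>V. \<lambda>t\<in>{0..}. N v t \<omega>) -` {n \<in> space ?S. \<forall>w\<in>V. n w t = j w} \<inter> space P = C j"
          using t by (auto simp: C_def space_PiM PiE_iff extensional_def)
      qed
    qed
    have C_ev: "C j \<in> events" for j
      using indep_setD_ev2[OF indMN] C_in by blast
    have probC: "prob (C j) = (\<Prod>v\<in>V. pmf (poisson_pmf t) (j v))" for j
      unfolding C_def by (rule independent_clocks_prob[OF P pois indN V t])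
    have prob_A0: "prob A0 = exp (- ?n * t)"
      using t by (simp add: A0_def probC exp_of_nat_mult[symmetric])
    have prob_A: "prob (A v) = t * exp (- ?n * t)" if "v \<in> V" for v
    proof -
      have "prob (A v) = (\<Prod>w\<in>V. exp (- t) * (if w = v then t else 1))"
        unfolding A_def probC using t by (intro prod.cong) auto
      also have "\<dots> = exp (- t) ^ card V * t"
        using V that by (simp add: prod.distrib)
      finally show ?thesis by (simp add: exp_of_nat_mult[symmetric])
    qed
    define L where "L \<omega> = (\<Sum>v\<in>V. indicator (A v) \<omega> * g v (X 0 \<omega>))" for \<omega>
    \<comment> \<open>\<open>U\<close> is the indicator of the exceptional event of at least two rings.\<close>
    define U where "U \<omega> = 1 - indicator A0 \<omega> - (\<Sum>v\<in>V. indicator (A v) \<omega> :: real)" for \<omega>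
    have pick: "(\<Sum>w\<in>V. indicator (A w) \<omega> * h w) = (h v :: real)"
      if "v \<in> V" "\<omega> \<in> A v" for v \<omega> h
    proof -
      have N: "N w t \<omega> = (if w = v then 1 else 0)" if "w \<in> V" for w
        using \<open>\<omega> \<in> A v\<close> \<open>w \<in> V\<close> unfolding A_def C_def by blast
      have only: "\<omega> \<notin> A w" if "w \<in> V" "w \<noteq> v" for w
      proof
        assume "\<omega> \<in> A w"
        then have "N w t \<omega> = (if w = w then 1 else 0)"
          using \<open>w \<in> V\<close> unfolding A_def C_def by blast
        with N[OF \<open>w \<in> V\<close>] \<open>w \<noteq> v\<close> show False by simp
      qed
      have "(\<Sum>w\<in>V. indicator (A w) \<omega> * h w) = (\<Sum>w\<in>{v}. indicator (A w) \<omega> * h w)"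
        using V only \<open>v \<in> V\<close> by (intro sum.mono_neutral_right) auto
      then show ?thesis using \<open>\<omega> \<in> A v\<close> by simp
    qed
    have disj: "\<omega> \<notin> A0" if "v \<in> V" "\<omega> \<in> A v" for v \<omega>
    proof
      assume "\<omega> \<in> A0"
      then have "N v t \<omega> = 0" using \<open>v \<in> V\<close> by (simp add: A0_def C_def)
      moreover have "N v t \<omega> = (if v = v then 1 else 0)"
        using that unfolding A_def C_def by blast
      ultimately show False by simp
    qed
    have clocks: "AE \<omega> in P. \<forall>v\<in>V. counting_path (\<lambda>t. N v t \<omega>)"
      using V poisson_process_counting_path[OF pois] by (intro AE_finite_allI) auto
    have ae: "AE \<omega> in P. \<bar>L \<omega> - (f (X t \<omega>) - f (X 0 \<omega>))\<bar> \<le> 2 * K * U \<omega>"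
      using path clocks AE_space
    proof eventually_elim
      case (elim \<omega>)
      show ?case
      proof (cases "\<exists>v\<in>V. \<omega> \<in> A v")
        case True
        then obtain v where v: "v \<in> V" "\<omega> \<in> A v" by auto
        have "M t x \<omega> = hit E D v (X 0 \<omega>) x" if "x \<in> V" for x
        proof -
          have "M t x \<omega> = hit E D v (\<lambda>x. M 0 x \<omega>) x"
            using elim v t that
            by (intro meteor_path_one_ring[where n = "\<lambda>v t. N v t \<omega>" and m = "\<lambda>t v. M t v \<omega>"])
               (auto simp: A_def C_def)
          then show ?thesis using that v by (simp add: hit_def X_def)
        qed
        then have "X t \<omega> = restrict (hit E D v (X 0 \<omega>)) V" by (auto simp: X_def)
        then have "L \<omega> = f (X t \<omega>) - f (X 0 \<omega>)"
          unfolding L_def pick[OF v] g_def by simp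
        moreover have "U \<omega> = 0"
          using pick[OF v, of "\<lambda>_. 1"] disj[OF v] by (simp add: U_def)
        ultimately show ?thesis by simp
      next
        case False
        then have 0: "L \<omega> = 0" "(\<Sum>v\<in>V. indicator (A v) \<omega> :: real) = 0"
          by (auto simp: L_def intro!: sum.neutral)
        show ?thesis
        proof (cases "\<omega> \<in> A0")
          case True
          have "M t x \<omega> = M 0 x \<omega>" if "x \<in> V" for x
            using elim t that True
            by (intro meteor_path_no_ring[where n = "\<lambda>v t. N v t \<omega>" and m = "\<lambda>t v. M t v \<omega>"])
               (auto simp: A0_def C_def)
          then have "X t \<omega> = X 0 \<omega>" by (auto simp: X_def)
          then show ?thesis using 0 True by (simp add: U_def)
        next
          case False
          then show ?thesis using 0 bdd[of "X t \<omega>"] bdd[of "X 0 \<omega>"] by (simp add: U_def)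
        qed
      qed
    qed
    have [measurable]: "A v \<in> events" "A0 \<in> events" for v
      using C_ev by (auto simp: A_def A0_def)
    have fX: "(\<lambda>\<omega>. f (X s \<omega>)) \<in> borel_measurable P" if "0 \<le> s" for s
      using measurable_comp[OF X[OF that] f] by (simp add: comp_def)
    have gX: "(\<lambda>\<omega>. g v (X 0 \<omega>)) \<in> borel_measurable P" if "v \<in> V" for v
      using measurable_comp[OF X[of 0] g[OF that]] by (simp add: comp_def)
    have int_f: "integrable P (\<lambda>\<omega>. f (X s \<omega>))" if "0 \<le> s" for s
      using fX[OF that] bdd by (intro integrable_const_bound[where B = K]) auto
    have int_Lv: "integrable P (\<lambda>\<omega>. indicator (A v) \<omega> * g v (X 0 \<omega>))" if "v \<in> V" for v
      using gX[OF that] gK[of v] K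
      by (intro integrable_const_bound[where B = "2 * K"]) (auto simp: indicator_def)
    have int_L: "integrable P L" unfolding L_def using int_Lv by auto
    have int_ind: "integrable P (indicator B :: _ \<Rightarrow> real)" if "B \<in> events" for B
      using that by (intro integrable_real_indicator) (auto simp: emeasure_eq_measure)
    have int_U: "integrable P U"
      unfolding U_def by (intro Bochner_Integration.integrable_diff Bochner_Integration.integrable_sum int_ind) auto
    have same: "expectation (\<lambda>\<omega>. f (X s \<omega>)) = (\<integral>m. f m \<partial>Q)" if "0 \<le> s" for s
      using integral_distr[OF X[OF that] f] lawX[OF that] by simp
    have EL: "expectation L = t * exp (- ?n * t) * R"
    proof -
      have "expectation L = (\<Sum>v\<in>V. expectation (\<lambda>\<omega>. indicator (A v) \<omega> * g v (X 0 \<omega>)))"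
        unfolding L_def using int_Lv by (simp add: Bochner_Integration.integral_sum)
      also have "\<dots> = (\<Sum>v\<in>V. prob (A v) * (\<integral>m. g v m \<partial>distr P ?B (X 0)))"
      proof (rule sum.cong[OF refl])
        fix v assume v: "v \<in> V"
        show "expectation (\<lambda>\<omega>. indicator (A v) \<omega> * g v (X 0 \<omega>)) = prob (A v) * (\<integral>m. g v m \<partial>distr P ?B (X 0))"
          by (rule indep_set_expectation[OF indMN[unfolded X0] X[OF order_refl] g[OF v] gK])
             (use C_in in \<open>auto simp: A_def\<close>)
      qed
      also have "\<dots> = t * exp (- ?n * t) * R"
        by (simp add: lawX prob_A R_def sum_distrib_left)
      finally show ?thesis .
    qed
    have EU: "expectation U = 1 - exp (- ?n * t) - ?n * (t * exp (- ?n * t))"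
      unfolding U_def by (simp add: int_ind prob_space prob_A0 prob_A)
    have "\<bar>expectation (\<lambda>\<omega>. L \<omega> - (f (X t \<omega>) - f (X 0 \<omega>)))\<bar> \<le> expectation (\<lambda>\<omega>. \<bar>L \<omega> - (f (X t \<omega>) - f (X 0 \<omega>))\<bar>)"
      by (rule integral_abs_bound)
    also have "\<dots> \<le> expectation (\<lambda>\<omega>. 2 * K * U \<omega>)"
      using ae int_L int_U int_f[of 0] int_f[of t] t by (intro integral_mono_AE) auto
    also have "expectation (\<lambda>\<omega>. L \<omega> - (f (X t \<omega>) - f (X 0 \<omega>))) = t * exp (- ?n * t) * R"
      using int_L int_f[of 0] int_f[of t] t by (simp add: EL same)
    also have "expectation (\<lambda>\<omega>. 2 * K * U \<omega>) = 2 * K * (1 - exp (- ?n * t) - ?n * (t * exp (- ?n * t)))"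
      using EU by simp
    finally have "t * \<bar>R\<bar> * exp (- (?n * t)) \<le> 2 * K * (exp (?n * t) - 1 - ?n * t) * exp (- (?n * t))"
      using t by (simp add: abs_mult algebra_simps exp_minus_inverse)
    then have "t * \<bar>R\<bar> \<le> 2 * K * (exp (?n * t) - 1 - ?n * t)" by simp
    also have "\<dots> \<le> 2 * K * (?n * t)\<^sup>2"
      using exp_bound[of "?n * t"] t nt K by (intro mult_left_mono) auto
    finally have "t * \<bar>R\<bar> \<le> t * (2 * K * ?n\<^sup>2 * t)" by (simp add: power2_eq_square algebra_simps)
    then show ?thesis using t by simp
  qed
  have "\<bar>R\<bar> \<le> 0"
  proof (rule tendsto_lowerbound)
    show "((\<lambda>t. 2 * K * ?n\<^sup>2 * t) \<longlongrightarrow> 0) (at_right 0)"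
      by (auto intro!: tendsto_eq_intros)
    have "0 < 1 / (?n + 1)" by simp
    moreover have "?n * t \<le> 1" if "0 < t" "t < 1 / (?n + 1)" for t
    proof -
      have "(?n + 1) * t < 1" using that by (simp add: field_simps)
      then show ?thesis using that by (simp add: algebra_simps)
    qed
    ultimately show "\<forall>\<^sub>F t in at_right 0. \<bar>R\<bar> \<le> 2 * K * ?n\<^sup>2 * t"
      unfolding eventually_at_right_field using bound by blast
  qed simp
  then show ?thesis by (simp add: R_def g_def)
qed

section \<open>The torus as a quotient of the lattice\<close>

definition unit_steps :: "(int ^ 'd) set" where
  "unit_steps = (\<lambda>(i, s). axis i s) ` (UNIV \<times> {1, -1})"

lemma axis_nth_if: "axis i s $ j = (if j = i then s else 0)"
  by (auto simp: axis_def)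

lemma unit_stepsI [intro]: "axis i 1 \<in> unit_steps" "axis i (-1) \<in> unit_steps"
  by (auto simp: unit_steps_def)

lemma unit_stepsE:
  assumes "u \<in> unit_steps"
  obtains i s where "u = axis i s" "s = 1 \<or> s = -1"
  using assms by (auto simp: unit_steps_def)

lemma card_unit_steps: "card (unit_steps :: (int ^ 'd) set) = 2 * CARD('d)"
proof -
  have "inj_on (\<lambda>(i :: 'd, s). axis i s :: int ^ 'd) (UNIV \<times> {1, -1})"
  proof (rule inj_onI, clarify)
    fix i j :: 'd and s t :: int
    assume st: "s \<in> {1, -1}" "t \<in> {1, -1}" and eq: "(axis i s :: int ^ 'd) = axis j t"
    have "axis i s $ i = (axis j t :: int ^ 'd) $ i" using eq by simp
    then show "i = j \<and> s = t" using st by (auto simp: axis_nth_if split: if_splits)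
  qed
  then show ?thesis unfolding unit_steps_def by (subst card_image) (auto simp: card_cartesian_product)
qed

lemma finite_unit_steps: "finite unit_steps"
  by (simp add: unit_steps_def)

text \<open>An integer vector of \<open>\<ell>\<^sup>1\<close>-norm 1 has exactly one nonzero entry, which is 1 or -1.\<close>

lemma lattice_adj_iff: "lattice_adj x y \<longleftrightarrow> y - x \<in> unit_steps"
proof
  assume adj: "lattice_adj x y"
  then have sum1: "(\<Sum>i\<in>UNIV. \<bar>x $ i - y $ i\<bar>) = 1" by (simp add: lattice_adj_def)
  then obtain i where i: "x $ i \<noteq> y $ i" by fastforce
  have split: "(\<Sum>i\<in>UNIV. \<bar>x $ i - y $ i\<bar>) = \<bar>x $ i - y $ i\<bar> + (\<Sum>j\<in>UNIV - {i}. \<bar>x $ j - y $ j\<bar>)"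
    by (rule sum.remove) auto
  have "0 \<le> (\<Sum>j\<in>UNIV - {i}. \<bar>x $ j - y $ j\<bar>)" by (intro sum_nonneg) auto
  with split sum1 i have s: "\<bar>x $ i - y $ i\<bar> = 1" and "(\<Sum>j\<in>UNIV - {i}. \<bar>x $ j - y $ j\<bar>) = 0" by linarith+
  then have "\<forall>j\<in>UNIV - {i}. \<bar>x $ j - y $ j\<bar> = 0" by (subst (asm) sum_nonneg_eq_0_iff) auto
  then have "y - x = axis i (y $ i - x $ i)" by (auto simp: vec_eq_iff axis_nth_if)
  moreover have "y $ i - x $ i = 1 \<or> y $ i - x $ i = -1" using s by arith
  ultimately show "y - x \<in> unit_steps" by auto
next
  assume "y - x \<in> unit_steps"
  then obtain i s where "y - x = axis i s" and s: "s = 1 \<or> s = -1" by (rule unit_stepsE)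
  then have "y $ j - x $ j = (if j = i then s else 0)" for j
  proof -
    have "y $ j - x $ j = (y - x) $ j" by simp
    then show ?thesis by (simp only: \<open>y - x = axis i s\<close> axis_nth_if)
  qed
  then have "\<bar>x $ j - y $ j\<bar> = (if j = i then 1 else 0)" for j
    using s by (smt (verit))
  then show "lattice_adj x y" by (simp add: lattice_adj_def)
qed

lemma nbrs_lattice: "nbrs UNIV lattice_adj x = (+) x ` unit_steps"
proof safe
  fix y assume "y \<in> nbrs UNIV lattice_adj x"
  then have "y - x \<in> unit_steps" by (simp add: nbrs_def lattice_adj_iff)
  then show "y \<in> (+) x ` unit_steps" by (intro image_eqI[of _ _ "y - x"]) auto
qed (auto simp: nbrs_def lattice_adj_iff)

lemma lattice_adj_sym: "lattice_adj x y \<Longrightarrow> lattice_adj y x"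
  by (simp add: lattice_adj_def abs_minus_commute)

lemma lattice_adj_step: "lattice_adj x (x + axis i 1)" "lattice_adj x (x - axis i 1)"
proof -
  have "x - axis i 1 - x = axis i (-1)" by (simp add: vec_eq_iff axis_nth_if)
  then show "lattice_adj x (x - axis i 1)" unfolding lattice_adj_iff by auto
qed (auto simp: lattice_adj_iff)

lemma lattice_regular: "regular_graph UNIV (lattice_adj :: int ^ 'd \<Rightarrow> _) (2 * CARD('d))"
proof
  fix x y :: "int ^ 'd"
  show "\<not> lattice_adj x x" by (simp add: lattice_adj_def)
  show "finite (nbrs UNIV lattice_adj x)" by (simp add: nbrs_lattice finite_unit_steps)
  show "card (nbrs UNIV lattice_adj x) = 2 * CARD('d)"
    by (simp add: nbrs_lattice card_image card_unit_steps)
  show "2 \<le> 2 * CARD('d)" by (simp add: Suc_le_eq)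
qed (auto intro: lattice_adj_sym)

lemma lattice_connected: "lattice_adj\<^sup>*\<^sup>* x y"
proof (induction "nat (\<Sum>i\<in>UNIV. \<bar>x $ i - y $ i\<bar>)" arbitrary: x rule: less_induct)
  case less
  show ?case
  proof (cases "x = y")
    case False
    then obtain i where i: "x $ i \<noteq> y $ i" by (auto simp: vec_eq_iff)
    define s where "s = sgn (y $ i - x $ i)"
    have s: "s = 1 \<or> s = -1" using i by (auto simp: s_def sgn_if)
    define z where "z = x + axis i s"
    have z: "z $ j = x $ j + (if j = i then s else 0)" for j by (simp add: z_def axis_nth_if)
    have adj: "lattice_adj x z" using s by (auto simp: z_def lattice_adj_iff)
    have "(\<Sum>i\<in>UNIV. \<bar>z $ i - y $ i\<bar>) < (\<Sum>i\<in>UNIV. \<bar>x $ i - y $ i\<bar>)"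
    proof (rule sum_strict_mono_ex1)
      show "\<exists>j\<in>UNIV. \<bar>z $ j - y $ j\<bar> < \<bar>x $ j - y $ j\<bar>"
        using i by (intro bexI[of _ i]) (auto simp: z s_def sgn_if)
    qed (use i in \<open>auto simp: z s_def sgn_if\<close>)
    moreover have "0 \<le> (\<Sum>i\<in>UNIV. \<bar>z $ i - y $ i\<bar>)" by (intro sum_nonneg) auto
    ultimately have "lattice_adj\<^sup>*\<^sup>* z y" by (intro less) linarith
    with adj show ?thesis by (rule converse_rtranclp_into_rtranclp)
  qed auto
qed

definition wrap :: "nat \<Rightarrow> int \<Rightarrow> int" where
  "wrap k a = (a + int (k div 2) - 1) mod int k + 1"

lemma torus_vertex_nth: "torus_vertex k x $ i = wrap k (x $ i)"
  by (simp add: torus_vertex_def wrap_def)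

lemma wrap_bounds: "0 < k \<Longrightarrow> wrap k a \<in> {1..int k}"
  by (auto simp: wrap_def intro: pos_mod_bound less_imp_le) (smt (verit) of_nat_0_less_iff pos_mod_bound)

lemma wrap_Suc:
  assumes "0 < k"
  shows "wrap k (a + 1) = (if wrap k a = int k then 1 else wrap k a + 1)"
proof -
  define m where "m = (a + int (k div 2) - 1) mod int k"
  have m: "0 \<le> m" "m < int k" using assms by (auto simp: m_def)
  have "(a + 1 + int (k div 2) - 1) mod int k = ((a + int (k div 2) - 1) + 1) mod int k"
    by (simp add: algebra_simps)
  also have "\<dots> = (m + 1) mod int k" unfolding m_def by (simp add: mod_add_left_eq)
  also have "\<dots> = (if m + 1 = int k then 0 else m + 1)"
    using m by auto
  finally show ?thesis by (simp add: wrap_def m_def[symmetric])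
qed

lemma circle_edge_wrap:
  assumes "0 < k"
  shows "circle_edge k (wrap k a) b \<longleftrightarrow> b = wrap k (a + 1)"
    and "circle_edge k b (wrap k a) \<longleftrightarrow> b = wrap k (a - 1)"
proof -
  show "circle_edge k (wrap k a) b \<longleftrightarrow> b = wrap k (a + 1)"
    using wrap_Suc[OF assms, of a] wrap_bounds[OF assms, of a] by (auto simp: circle_edge_def)
  show "circle_edge k b (wrap k a) \<longleftrightarrow> b = wrap k (a - 1)"
    using wrap_Suc[OF assms, of "a - 1"] wrap_bounds[OF assms, of "a - 1"]
    by (auto simp: circle_edge_def split: if_splits)
qed

lemma wrap_inj:
  assumes "wrap k a = wrap k b" "\<bar>a - b\<bar> < int k"
  shows "a = b"
proof -
  have "int k dvd a - b"
    using assms(1) by (simp add: wrap_def mod_eq_dvd_iff)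
  then show ?thesis using assms(2) dvd_imp_le_int[of "a - b" "int k"] by fastforce
qed

lemma torus_vertex_inj_on:
  assumes "\<And>a b i. a \<in> F \<Longrightarrow> b \<in> F \<Longrightarrow> \<bar>a $ i - b $ i\<bar> < int k"
  shows "inj_on (torus_vertex k) F"
proof (rule inj_onI)
  fix a b assume ab: "a \<in> F" "b \<in> F" and eq: "torus_vertex k a = torus_vertex k b"
  have "wrap k (a $ i) = wrap k (b $ i)" for i
    using eq by (metis torus_vertex_nth)
  then have "a $ i = b $ i" for i by (rule wrap_inj) (rule assms[OF ab])
  then show "a = b" by (simp add: vec_eq_iff)
qed

lemma eventually_torus_vertex_inj_on:
  assumes "finite (F :: (int ^ 'd) set)"
  shows "\<forall>\<^sub>F k in sequentially. inj_on (torus_vertex k) F"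
proof -
  define B where "B = Max (insert 0 ((\<lambda>(a, b, i). \<bar>a $ i - b $ i\<bar>) ` (F \<times> F \<times> UNIV)))"
  have B: "\<bar>a $ i - b $ i\<bar> \<le> B" if "a \<in> F" "b \<in> F" for a b i
    unfolding B_def using assms that by (intro Max_ge) force+
  show ?thesis
    using eventually_gt_at_top[of "nat B"]
  proof eventually_elim
    case (elim k)
    show ?case
    proof (rule torus_vertex_inj_on)
      fix a b :: "int ^ 'd" and i assume "a \<in> F" "b \<in> F"
      from B[OF this, of i] elim show "\<bar>a $ i - b $ i\<bar> < int k" by linarith
    qed
  qed
qed

lemma torus_vertex_in_torus: "0 < k \<Longrightarrow> torus_vertex k x \<in> torus k"
  using wrap_bounds by (simp add: torus_def torus_vertex_nth)

lemma torus_vertex_surj: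
  assumes "x \<in> torus k"
  obtains y where "x = torus_vertex k y"
proof
  have "wrap k (x $ i - int (k div 2)) = x $ i" for i
  proof -
    have "0 \<le> x $ i - 1" "x $ i - 1 < int k" using assms by (auto simp: torus_def algebra_simps) (smt (verit))+
    then show ?thesis by (simp add: wrap_def)
  qed
  then show "x = torus_vertex k (\<chi> i. x $ i - int (k div 2))"
    by (simp add: vec_eq_iff torus_vertex_nth)
qed

lemma torus_adj_sym:
  assumes "torus_adj k x y"
  shows "torus_adj k y x"
proof -
  obtain i where "circle_edge k (x $ i) (y $ i) \<or> circle_edge k (y $ i) (x $ i)" "\<forall>j. j \<noteq> i \<longrightarrow> x $ j = y $ j"
    using assms unfolding torus_adj_def by blast
  then show ?thesis using assms unfolding torus_adj_def by (intro conjI exI[of _ i]) auto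
qed

text \<open>The projection of the lattice onto the torus is a covering map: it carries the neighbours of a
  vertex onto the neighbours of its image. Degrees, connectedness and the Laplacian of the torus
  are read off from the lattice through it.\<close>

lemma torus_adj_torus_vertex:
  assumes "0 < k"
  shows "torus_adj k (torus_vertex k x) y \<longleftrightarrow> (\<exists>z. lattice_adj x z \<and> y = torus_vertex k z)"
proof
  assume "torus_adj k (torus_vertex k x) y"
  then obtain i where "y $ i = wrap k (x $ i + 1) \<or> y $ i = wrap k (x $ i - 1)"
    and "\<forall>j. j \<noteq> i \<longrightarrow> wrap k (x $ j) = y $ j"
    unfolding torus_adj_def torus_vertex_nth circle_edge_wrap[OF assms] by blast
  then have i: "y $ i = wrap k (x $ i + 1) \<or> y $ i = wrap k (x $ i - 1)"
    and j: "\<And>j. j \<noteq> i \<Longrightarrow> y $ j = wrap k (x $ j)" by auto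
  from i show "\<exists>z. lattice_adj x z \<and> y = torus_vertex k z"
  proof
    assume "y $ i = wrap k (x $ i + 1)"
    then have "y = torus_vertex k (x + axis i 1)"
      using j by (auto simp: vec_eq_iff torus_vertex_nth axis_nth_if)
    then show ?thesis using lattice_adj_step by blast
  next
    assume "y $ i = wrap k (x $ i - 1)"
    then have "y = torus_vertex k (x - axis i 1)"
      using j by (auto simp: vec_eq_iff torus_vertex_nth axis_nth_if)
    then show ?thesis using lattice_adj_step by blast
  qed
next
  assume "\<exists>z. lattice_adj x z \<and> y = torus_vertex k z"
  then obtain z where "z - x \<in> unit_steps" and y: "y = torus_vertex k z" by (auto simp: lattice_adj_iff)
  then obtain i s where zs: "z - x = axis i s" and s: "s = 1 \<or> s = -1" by (auto elim: unit_stepsE)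
  then have z: "z $ j = x $ j + (if j = i then s else 0)" for j
  proof -
    have "z $ j = x $ j + (z - x) $ j" by simp
    then show ?thesis by (simp only: zs axis_nth_if)
  qed
  show "torus_adj k (torus_vertex k x) y"
    unfolding torus_adj_def
  proof (intro conjI exI[of _ i])
    show "circle_edge k (torus_vertex k x $ i) (y $ i) \<or> circle_edge k (y $ i) (torus_vertex k x $ i)"
      using s by (auto simp: y torus_vertex_nth z circle_edge_wrap[OF assms])
  qed (simp_all add: y torus_vertex_in_torus[OF assms] torus_vertex_nth z)
qed

lemma nbrs_torus:
  assumes "0 < k"
  shows "nbrs (torus k) (torus_adj k) (torus_vertex k x) = torus_vertex k ` nbrs UNIV lattice_adj x"
  using torus_vertex_in_torus[OF assms] by (auto simp: nbrs_def torus_adj_torus_vertex[OF assms])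

lemma bij_torus: "bij_betw vec_lambda (UNIV \<rightarrow>\<^sub>E {1..int k}) (torus k :: (int ^ 'd) set)"
  by (rule bij_betwI[where g = vec_nth]) (auto simp: torus_def)

lemma finite_torus: "finite (torus k)"
  using bij_betw_finite[OF bij_torus] by (simp add: finite_PiE)

lemma card_torus: "card (torus k :: (int ^ 'd) set) = k ^ CARD('d)"
  using bij_betw_same_card[OF bij_torus, where ?'d1 = 'd] by (simp add: card_PiE)

text \<open>For \<open>k = 2\<close> the two neighbours of a vertex in a given direction would coincide; from \<open>k = 3\<close> on the
  projection is injective on each neighbourhood.\<close>

lemma torus_regular:
  assumes k: "3 \<le> k"
  shows "regular_graph (torus k) (torus_adj k :: int ^ 'd \<Rightarrow> _) (2 * CARD('d))"
proof
  fix x y :: "int ^ 'd"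
  show "torus_adj k x y \<Longrightarrow> torus_adj k y x" by (rule torus_adj_sym)
  show "\<not> torus_adj k x x" using k by (auto simp: torus_adj_def circle_edge_def)
  show "torus_adj k x y \<Longrightarrow> y \<in> torus k" by (simp add: torus_adj_def)
  show "finite (nbrs (torus k) (torus_adj k) x)" 
    by (rule finite_subset[OF _ finite_torus[of k]]) (auto simp: nbrs_def)
  show "2 \<le> 2 * CARD('d)" by (simp add: Suc_le_eq)
  assume "x \<in> torus k"
  then obtain z where z: "x = torus_vertex k z" by (rule torus_vertex_surj)
  have "inj_on (torus_vertex k) (nbrs UNIV lattice_adj z)"
  proof (rule torus_vertex_inj_on)
    fix a b :: "int ^ 'd" and i
    assume "a \<in> nbrs UNIV lattice_adj z" "b \<in> nbrs UNIV lattice_adj z"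
    then obtain u v where "a = z + u" "b = z + v" "u \<in> unit_steps" "v \<in> unit_steps"
      by (auto simp: nbrs_lattice)
    moreover have "\<bar>w $ i\<bar> \<le> 1" if "w \<in> unit_steps" for w :: "int ^ 'd"
      using that by (auto elim!: unit_stepsE simp: axis_nth_if)
    ultimately have "\<bar>u $ i\<bar> \<le> 1" "\<bar>v $ i\<bar> \<le> 1" "a $ i - b $ i = u $ i - v $ i" by auto
    then show "\<bar>a $ i - b $ i\<bar> < int k" using k by linarith
  qed
  then show "card (nbrs (torus k) (torus_adj k) x) = 2 * CARD('d)"
    using k by (simp add: z nbrs_torus card_image) (simp add: nbrs_lattice card_image card_unit_steps)
qed

lemma torus_connected:
  assumes k: "0 < k" and "x \<in> torus k" "y \<in> torus k"
  shows "(torus_adj k)\<^sup>*\<^sup>* x y"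
proof -
  obtain a where a: "x = torus_vertex k a" using assms(2) by (rule torus_vertex_surj)
  obtain b where b: "y = torus_vertex k b" using assms(3) by (rule torus_vertex_surj)
  have "(torus_adj k)\<^sup>*\<^sup>* (torus_vertex k a) (torus_vertex k b)"
    using lattice_connected[of a b]
  proof (induction rule: rtranclp_induct)
    case (step u v)
    have "torus_adj k (torus_vertex k u) (torus_vertex k v)"
      using torus_adj_torus_vertex[OF k] step.hyps(2) by blast
    with step.IH show ?case by (rule rtranclp.rtrancl_into_rtrancl)
  qed auto
  then show ?thesis by (simp add: a b)
qed

lemma lap_torus_vertex:
  assumes k: "0 < k" and inj: "inj_on (torus_vertex k) F"
    and F: "v \<in> F" "x \<in> F" "nbrs UNIV lattice_adj x \<subseteq> F"
  shows "lap (torus_adj k) D (torus_vertex k v) (torus_vertex k x) = lap lattice_adj D v x"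
proof -
  have "torus_vertex k x = torus_vertex k v \<longleftrightarrow> x = v" using inj_on_eq_iff[OF inj] F by auto
  moreover have "torus_adj k (torus_vertex k v) (torus_vertex k x) \<longleftrightarrow> lattice_adj v x"
  proof -
    have "torus_adj k (torus_vertex k v) (torus_vertex k x) \<longleftrightarrow> torus_adj k (torus_vertex k x) (torus_vertex k v)"
      using torus_adj_sym by blast
    also have "\<dots> \<longleftrightarrow> (\<exists>z. lattice_adj x z \<and> torus_vertex k v = torus_vertex k z)"
      by (rule torus_adj_torus_vertex[OF k])
    also have "\<dots> \<longleftrightarrow> lattice_adj x v"
      using inj_on_eq_iff[OF inj F(1)] F(3) by (auto simp: nbrs_def)
    finally show ?thesis using lattice_adj_sym by blast
  qed
  ultimately show ?thesis by (simp add: lap_def)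
qed

section \<open>Moments of stationary distributions on tori\<close>

text \<open>Test functions for weak convergence have to be bounded and continuous, so products of masses are
  approximated by products of truncated masses. The truncation from below at 0 is harmless as
  masses are nonnegative.\<close>

definition cutoff :: "real \<Rightarrow> real \<Rightarrow> real" where
  "cutoff K a = max 0 (min a K)"

lemma cutoff_bounds: "0 \<le> cutoff K a" "0 \<le> K \<Longrightarrow> cutoff K a \<le> K" "cutoff K a \<le> \<bar>a\<bar>"
  by (auto simp: cutoff_def)

lemma cutoff_id: "0 \<le> a \<Longrightarrow> a \<le> K \<Longrightarrow> cutoff K a = a"
  by (auto simp: cutoff_def)

lemma continuous_on_cutoff [continuous_intros]:
  "continuous_on S f \<Longrightarrow> continuous_on S (\<lambda>x. cutoff K (f x))"
  unfolding cutoff_def by (intro continuous_intros)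

lemma cutoff_measurable [measurable]: "cutoff K \<in> borel_measurable borel"
  unfolding cutoff_def by measurable

lemma cutoff_product_le:
  assumes "0 \<le> K"
  shows "\<bar>cutoff K a * cutoff K b\<bar> \<le> K * K"
  using cutoff_bounds[of K] assms by (simp add: abs_mult mult_mono)

lemma stationary_distribution_basic:
  fixes V :: "'v set"
  assumes V: "finite V" and stat: "stationary_distribution V E Q"
  shows "prob_space Q" "sets Q = sets (PiM V (\<lambda>_. borel))" "AE m in Q. \<forall>v\<in>V. 0 \<le> m v"
proof -
  let ?B = "PiM V (\<lambda>_. borel :: real measure)"
  obtain P :: "(('v \<Rightarrow> real) \<times> ('v \<Rightarrow> real \<Rightarrow> nat)) measure" and N M
    where proc: "meteor_process P V E N M" and laws: "\<forall>t\<ge>0. law_at P V M t = Q"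
    using stat unfolding stationary_distribution_def by blast
  have law: "law_at P V M 0 = Q" using laws by simp
  interpret prob_space P using proc by (simp add: meteor_process_def)
  have M: "(\<lambda>\<omega>. \<lambda>v\<in>V. M 0 v \<omega>) \<in> measurable P ?B"
    using proc by (intro measurable_restrict) (auto simp: meteor_process_def)
  have Q: "Q = distr P ?B (\<lambda>\<omega>. \<lambda>v\<in>V. M 0 v \<omega>)" using law by (simp add: law_at_def)
  show "prob_space Q" unfolding Q by (rule prob_space_distr[OF M])
  show "sets Q = sets ?B" by (simp add: Q)
  have pos: "AE \<omega> in P. \<forall>v\<in>V. 0 \<le> M 0 v \<omega>"
    using proc unfolding meteor_process_def by auto
  show "AE m in Q. \<forall>v\<in>V. 0 \<le> m v"
    unfolding Q
  proof (subst AE_distr_iff[OF M])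
    show "{m \<in> space ?B. \<forall>v\<in>V. 0 \<le> m v} \<in> sets ?B"
      using V by (intro sets.sets_Collect_finite_All) measurable
    show "AE \<omega> in P. \<forall>v\<in>V. 0 \<le> (\<lambda>v\<in>V. M 0 v \<omega>) v"
      using pos by eventually_elim simp
  qed
qed

context regular_graph
begin

lemma hit_product_diff:
  "hit E D v m x * hit E D v m y - m x * m y = drift (\<lambda>a b. m a * m b) x y v"
  by (simp add: hit_def drift_def algebra_simps)

lemma hit_bounds:
  assumes "0 \<le> m x" "0 \<le> m v"
  shows "0 \<le> hit E D v m x" "hit E D v m x \<le> m x + m v"
proof -
  have D: "1 / real D \<le> 1" using degree_ge_2 by simp
  have "lap E D v x \<le> 1" using D by (simp add: lap_def)
  then have "m v * lap E D v x \<le> m v" using assms mult_left_mono[of "lap E D v x" 1 "m v"] by simp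
  then show "hit E D v m x \<le> m x + m v" by (simp add: hit_def)
  show "0 \<le> hit E D v m x" using assms by (simp add: hit_def lap_def)
qed

text \<open>As the total mass is \<open>card V\<close>, masses before and after a ring stay below \<open>2 * card V\<close>, so a bounded
  test function suffices to obtain the balance equations from \<open>stationary_generator\<close>. The mean is
  recovered from the second moments, since summing \<open>m x * m y\<close> over \<open>y\<close> gives \<open>card V * m x\<close>.\<close>

lemma finite_stationary_moments:
  assumes V: "finite V" and stat: "stationary_distribution V E Q"
    and conn: "\<And>x y. x \<in> V \<Longrightarrow> y \<in> V \<Longrightarrow> E\<^sup>*\<^sup>* x y"
    and total: "AE m in Q. (\<Sum>v\<in>V. m v) = real (card V)"
    and x: "x \<in> V" and y: "y \<in> V"
  shows "integrable Q (\<lambda>m. m x)" "(\<integral>m. m x \<partial>Q) = 1"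
    and "integrable Q (\<lambda>m. m x * m y)" "(\<integral>m. m x * m y \<partial>Q) = stationary_moment x y"
proof -
  let ?n = "real (card V)"
  note basic = stationary_distribution_basic[OF V stat]
  interpret Q: prob_space Q by (rule basic)
  have meas [measurable]: "(\<lambda>m. m v) \<in> borel_measurable Q" if "v \<in> V" for v
    using that by (subst measurable_cong_sets[OF basic(2) refl]) measurable
  have range: "AE m in Q. \<forall>v\<in>V. 0 \<le> m v \<and> m v \<le> ?n"
    using basic(3) total
  proof eventually_elim
    case (elim m)
    then show ?case using V member_le_sum[of _ V m] by auto
  qed
  have int1: "integrable Q (\<lambda>m. m v)" if "v \<in> V" for v
    using range that by (intro Q.integrable_const_bound[where B = ?n]) (auto elim!: eventually_mono)
  have int2: "integrable Q (\<lambda>m. m v * m w)" if "v \<in> V" "w \<in> V" for v w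
  proof (rule Q.integrable_const_bound[where B = "?n * ?n"])
    show "AE m in Q. norm (m v * m w) \<le> ?n * ?n"
      using range that by (auto elim!: eventually_mono simp: abs_mult intro!: mult_mono)
  qed (use that in measurable)
  define c where "c v w = (\<integral>m. m v * m w \<partial>Q)" for v w
  have c_drift: "(\<integral>m. drift (\<lambda>a b. m a * m b) v w z \<partial>Q) = drift c v w z"
    if "v \<in> V" "w \<in> V" "z \<in> V" for v w z
    using int2 that by (simp add: drift_def c_def)
  have bal: "balanced c"
    unfolding balanced_def
  proof safe
    fix v w assume v: "v \<in> V" and w: "w \<in> V"
    let ?K = "2 * ?n"
    define f where "f m = cutoff ?K (m v) * cutoff ?K (m w)" for m
    have f: "f \<in> borel_measurable (PiM V (\<lambda>_. borel))"
      unfolding f_def using v w by measurable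
    have "(\<integral>m. f (restrict (hit E D z m) V) - f m \<partial>Q) = drift c v w z" if z: "z \<in> V" for z
    proof -
      have "(\<integral>m. f (restrict (hit E D z m) V) - f m \<partial>Q) = (\<integral>m. drift (\<lambda>a b. m a * m b) v w z \<partial>Q)"
      proof (rule integral_cong_AE)
        have "(\<lambda>m. hit E D z m u) \<in> borel_measurable Q" if "u \<in> V" for u
          unfolding hit_def using z that by measurable
        then show "(\<lambda>m. f (restrict (hit E D z m) V) - f m) \<in> borel_measurable Q"
          unfolding f_def using v w by simp measurable
        show "(\<lambda>m. drift (\<lambda>a b. m a * m b) v w z) \<in> borel_measurable Q"
          unfolding drift_def using v w z by measurable
        show "AE m in Q. f (restrict (hit E D z m) V) - f m = drift (\<lambda>a b. m a * m b) v w z"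
          using range
        proof eventually_elim
          case (elim m)
          have "cutoff ?K (hit E D z m u) = hit E D z m u" "cutoff ?K (m u) = m u" if "u \<in> V" for u
          proof -
            have b: "0 \<le> m u" "m u \<le> ?n" "0 \<le> m z" "m z \<le> ?n" using elim z that by auto
            have "0 \<le> hit E D z m u" "hit E D z m u \<le> ?K" using hit_bounds[OF b(1,3)] b by auto
            then show "cutoff ?K (hit E D z m u) = hit E D z m u" by (rule cutoff_id)
            show "cutoff ?K (m u) = m u" using b by (intro cutoff_id) auto
          qed
          then show ?case using v w by (simp add: f_def hit_product_diff)
        qed
      qed
      with c_drift v w z show ?thesis by simp
    qed
    moreover have "(\<Sum>z\<in>V. \<integral>m. f (restrict (hit E D z m) V) - f m \<partial>Q) = 0"
      by (rule stationary_generator[OF V stat f, where K = "?K * ?K"])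
         (unfold f_def, rule cutoff_product_le, simp)
    ultimately have "(\<Sum>z\<in>V. drift c v w z) = 0" by simp
    then show "(\<Sum>z\<in>star v \<union> star w. drift c v w z) = 0"
      using V v w by (subst (asm) sum_drift_superset) (auto simp: star_def nbrs_def)
  qed
  have row: "(\<Sum>w\<in>V. c v w) = ?n * (\<integral>m. m v \<partial>Q)" if v: "v \<in> V" for v
  proof -
    have "(\<Sum>w\<in>V. c v w) = (\<integral>m. (\<Sum>w\<in>V. m v * m w) \<partial>Q)"
      unfolding c_def using int2 v by simp
    also have "\<dots> = (\<integral>m. ?n * m v \<partial>Q)"
    proof (rule integral_cong_AE)
      show "AE m in Q. (\<Sum>w\<in>V. m v * m w) = ?n * m v"
        using total by eventually_elim (simp add: sum_distrib_left[symmetric])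
    qed (use v in measurable)
    finally show ?thesis by simp
  qed
  have sum_c: "(\<Sum>v\<in>V. \<Sum>w\<in>V. c v w) = ?n\<^sup>2"
  proof -
    have "(\<Sum>v\<in>V. \<Sum>w\<in>V. c v w) = ?n * (\<Sum>v\<in>V. \<integral>m. m v \<partial>Q)"
      by (simp add: row sum_distrib_left)
    also have "(\<Sum>v\<in>V. \<integral>m. m v \<partial>Q) = (\<integral>m. (\<Sum>v\<in>V. m v) \<partial>Q)"
      using int1 by simp
    also have "\<dots> = (\<integral>m. ?n \<partial>Q)"
      by (rule integral_cong_AE) (use total in auto)
    finally show ?thesis by (simp add: Q.prob_space power2_eq_square)
  qed
  have "c v w = c w v" for v w by (simp add: c_def mult.commute)
  then have c: "c v w = stationary_moment v w" if "v \<in> V" "w \<in> V" for v w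
    by (rule balanced_eq_stationary_moment[OF V bal _ conn sum_c that])
  have "star x \<subseteq> V" using x by (auto simp: star_def nbrs_def)
  from sum_stationary_moment[OF V this x] have "(\<Sum>w\<in>V. c x w) = ?n"
    using c x by (simp add: stationary_moment_def lap_sym[of x])
  with row[OF x] show "(\<integral>m. m x \<partial>Q) = 1" using x V by auto
  show "(\<integral>m. m x * m y \<partial>Q) = stationary_moment x y" using c[OF x y] by (simp add: c_def)
  show "integrable Q (\<lambda>m. m x)" "integrable Q (\<lambda>m. m x * m y)" using int1 int2 x y by auto
qed

end

interpretation lattice: regular_graph UNIV "lattice_adj :: int ^ 'd \<Rightarrow> _" "2 * CARD('d)"
  by (rule lattice_regular)

lemma periodic_extension_measurable:
  assumes k: "0 < k" and Q: "sets Q = sets (PiM (torus k) (\<lambda>_. borel))"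
  shows "periodic_extension k \<in> measurable Q (borel :: (int ^ 'd \<Rightarrow> real) measure)"
proof -
  have "periodic_extension k \<in> measurable (PiM (torus k) (\<lambda>_. borel)) (PiM UNIV (\<lambda>_. borel :: real measure))"
    unfolding periodic_extension_def
    by (intro measurable_PiM_single' measurable_component_singleton torus_vertex_in_torus[OF k]) simp
  then show ?thesis
    unfolding measurable_cong_sets[OF Q sets_PiM_equal_borel[symmetric]] .
qed

text \<open>As soon as the projection onto the torus is injective on the stars of \<open>x\<close> and \<open>y\<close>, the torus looks
  like the lattice there: both the moments and the generator, applied to a truncated product, take
  their lattice form for the periodic extension.\<close>

lemma torus_stationary_moments:
  assumes k: "3 \<le> k" and stat: "torus_stationary k (Q :: (int ^ 'd \<Rightarrow> real) measure)"
    and inj: "inj_on (torus_vertex k) (lattice.star x \<union> lattice.star y)"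
  defines "\<mu> \<equiv> distr Q borel (periodic_extension k)"
  shows "prob_space \<mu>" "AE m in \<mu>. 0 \<le> m x"
    and "integrable \<mu> (\<lambda>m. m x)" "(\<integral>m. m x \<partial>\<mu>) = 1"
    and "integrable \<mu> (\<lambda>m. m x * m y)" "(\<integral>m. m x * m y \<partial>\<mu>) = lattice.stationary_moment x y"
    and "0 \<le> K \<Longrightarrow> (\<Sum>v\<in>lattice.star x \<union> lattice.star y.
          \<integral>m. cutoff K (hit lattice_adj (2 * CARD('d)) v m x) * cutoff K (hit lattice_adj (2 * CARD('d)) v m y)
              - cutoff K (m x) * cutoff K (m y) \<partial>\<mu>) = 0"
proof -
  let ?V = "torus k :: (int ^ 'd) set" and ?E = "torus_adj k :: int ^ 'd \<Rightarrow> _" and ?D = "2 * CARD('d)"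
  let ?t = "torus_vertex k :: int ^ 'd \<Rightarrow> _" and ?F = "lattice.star x \<union> lattice.star y"
  interpret torus: regular_graph ?V ?E ?D using k by (rule torus_regular)
  have k0: "0 < k" using k by simp
  have st: "stationary_distribution ?V ?E Q" and tot: "AE m in Q. (\<Sum>v\<in>?V. m v) = real (card ?V)"
    using stat by (auto simp: torus_stationary_def card_torus)
  note basic = stationary_distribution_basic[OF finite_torus st]
  interpret Q: prob_space Q by (rule basic)
  have t: "?t v \<in> ?V" for v by (rule torus_vertex_in_torus[OF k0])
  have ext: "periodic_extension k \<in> measurable Q borel"
    by (rule periodic_extension_measurable[OF k0 basic(2)])
  have coord: "(\<lambda>m. m v) \<in> borel_measurable (borel :: (int ^ 'd \<Rightarrow> real) measure)" for v
    by (intro borel_measurable_continuous_onI) simp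
  have coord2: "(\<lambda>m. m v * m w) \<in> borel_measurable (borel :: (int ^ 'd \<Rightarrow> real) measure)" for v w
    by (rule borel_measurable_times[OF coord coord])
  note moments = torus.finite_stationary_moments[OF finite_torus st torus_connected[OF k0] tot t t]
  show "prob_space \<mu>" unfolding \<mu>_def by (rule Q.prob_space_distr[OF ext])
  show "AE m in \<mu>. 0 \<le> m x"
    unfolding \<mu>_def
  proof (subst AE_distr_iff[OF ext])
    have "(\<lambda>m. m x) -` {0..} \<inter> space borel \<in> sets (borel :: (int ^ 'd \<Rightarrow> real) measure)"
      by (rule measurable_sets[OF coord]) simp
    also have "(\<lambda>m. m x) -` {0..} \<inter> space borel = {m \<in> space borel. 0 \<le> m x}" by auto
    finally show "{m \<in> space borel. 0 \<le> m x} \<in> sets (borel :: (int ^ 'd \<Rightarrow> real) measure)" .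
    show "AE m in Q. 0 \<le> periodic_extension k m x"
      using basic(3) by eventually_elim (simp add: periodic_extension_def t)
  qed
  show "integrable \<mu> (\<lambda>m. m x)"
    unfolding \<mu>_def integrable_distr_eq[OF ext coord] periodic_extension_def by (rule moments(1))
  show "(\<integral>m. m x \<partial>\<mu>) = 1"
    unfolding \<mu>_def integral_distr[OF ext coord] periodic_extension_def by (rule moments(2))
  show "integrable \<mu> (\<lambda>m. m x * m y)"
    unfolding \<mu>_def integrable_distr_eq[OF ext coord2] periodic_extension_def by (rule moments(3))
  have inF: "x \<in> ?F" "y \<in> ?F" "nbrs UNIV lattice_adj x \<subseteq> ?F" "nbrs UNIV lattice_adj y \<subseteq> ?F"
    by (auto simp: lattice.star_def)
  have lap_x: "lap ?E ?D (?t v) (?t x) = lap lattice_adj ?D v x"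
    and lap_y: "lap ?E ?D (?t v) (?t y) = lap lattice_adj ?D v y" if "v \<in> ?F" for v
    by (rule lap_torus_vertex[OF k0 inj that]; fact inF)+
  have "torus.stationary_moment (?t x) (?t y) = lattice.stationary_moment x y"
    using lap_y inF by (simp add: torus.stationary_moment_def lattice.stationary_moment_def)
  then show "(\<integral>m. m x * m y \<partial>\<mu>) = lattice.stationary_moment x y"
    unfolding \<mu>_def integral_distr[OF ext coord2] periodic_extension_def using moments(4)[of x y] by simp
  show "(\<Sum>v\<in>?F. \<integral>m. cutoff K (hit lattice_adj ?D v m x) * cutoff K (hit lattice_adj ?D v m y)
              - cutoff K (m x) * cutoff K (m y) \<partial>\<mu>) = 0" if K: "0 \<le> K"
  proof -
    define f where "f m = cutoff K (m (?t x)) * cutoff K (m (?t y))" for m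
    define I where "I w = (\<integral>m. f (restrict (hit ?E ?D w m) ?V) - f m \<partial>Q)" for w
    have f: "f \<in> borel_measurable (PiM ?V (\<lambda>_. borel))"
      unfolding f_def using t by measurable
    have "(\<integral>m. cutoff K (hit lattice_adj ?D v m x) * cutoff K (hit lattice_adj ?D v m y)
              - cutoff K (m x) * cutoff K (m y) \<partial>\<mu>) = I (?t v)" if v: "v \<in> ?F" for v
    proof -
      have "hit lattice_adj ?D v (periodic_extension k m) x = hit ?E ?D (?t v) m (?t x)"
        "hit lattice_adj ?D v (periodic_extension k m) y = hit ?E ?D (?t v) m (?t y)" for m
        using lap_x[OF v] lap_y[OF v] by (simp_all add: hit_def periodic_extension_def)
      note hits = this
      have "(\<lambda>m. hit lattice_adj ?D v m z) \<in> borel_measurable (borel :: (int ^ 'd \<Rightarrow> real) measure)" for z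
        unfolding hit_def by (intro borel_measurable_add borel_measurable_times coord borel_measurable_const)
      then have "(\<lambda>m. cutoff K (hit lattice_adj ?D v m x) * cutoff K (hit lattice_adj ?D v m y)
          - cutoff K (m x) * cutoff K (m y)) \<in> borel_measurable (borel :: (int ^ 'd \<Rightarrow> real) measure)"
        by (intro borel_measurable_diff borel_measurable_times measurable_compose[OF _ cutoff_measurable] coord)
      from integral_distr[OF ext this] have "(\<integral>m. cutoff K (hit lattice_adj ?D v m x) * cutoff K (hit lattice_adj ?D v m y)
              - cutoff K (m x) * cutoff K (m y) \<partial>\<mu>) =
         (\<integral>m. cutoff K (hit lattice_adj ?D v (periodic_extension k m) x)
              * cutoff K (hit lattice_adj ?D v (periodic_extension k m) y)
              - cutoff K (periodic_extension k m x) * cutoff K (periodic_extension k m y) \<partial>Q)"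
        unfolding \<mu>_def .
      then show ?thesis
        unfolding I_def f_def hits by (simp add: t periodic_extension_def)
    qed
    then have "(\<Sum>v\<in>?F. \<integral>m. cutoff K (hit lattice_adj ?D v m x) * cutoff K (hit lattice_adj ?D v m y)
              - cutoff K (m x) * cutoff K (m y) \<partial>\<mu>) = (\<Sum>v\<in>?F. I (?t v))"
      by simp
    also have "\<dots> = (\<Sum>w\<in>?t ` ?F. I w)"
      using inj by (simp add: sum.reindex)
    \<comment> \<open>Rings outside the images of the stars leave both coordinates unchanged.\<close>
    also have "\<dots> = (\<Sum>w\<in>?V. I w)"
    proof (rule sum.mono_neutral_left)
      show "finite ?V" by (rule finite_torus)
      show "?t ` ?F \<subseteq> ?V" using t by auto
      show "\<forall>w\<in>?V - ?t ` ?F. I w = 0"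
      proof
        fix w assume w: "w \<in> ?V - ?t ` ?F"
        have "torus.star (?t z) = ?t ` lattice.star z" for z
          by (simp add: torus.star_def lattice.star_def nbrs_torus[OF k0])
        then have "w \<notin> torus.star (?t x)" "w \<notin> torus.star (?t y)" using w by auto
        then have "lap ?E ?D w (?t x) = 0" "lap ?E ?D w (?t y) = 0" using torus.lap_eq_0 by auto
        then show "I w = 0" by (simp add: I_def f_def hit_def t)
      qed
    qed
    also have "\<dots> = 0"
      unfolding I_def by (rule torus.stationary_generator[OF finite_torus st f, where K = "K * K"])
        (unfold f_def, rule cutoff_product_le[OF K])
    finally show ?thesis .
  qed
qed

section \<open>Passing to the limit\<close>

locale torus_limit =
  fixes Qk :: "nat \<Rightarrow> (int ^ 'd \<Rightarrow> real) measure" and Q :: "(int ^ 'd \<Rightarrow> real) measure"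
  assumes torus_stat: "\<And>k. 3 \<le> k \<Longrightarrow> torus_stationary k (Qk k)"
    and weak: "converges_weakly (\<lambda>k. distr (Qk k) borel (periodic_extension k)) Q"
begin

abbreviation \<mu> :: "nat \<Rightarrow> (int ^ 'd \<Rightarrow> real) measure" where
  "\<mu> k \<equiv> distr (Qk k) borel (periodic_extension k)"

abbreviation lattice_hit :: "int ^ 'd \<Rightarrow> (int ^ 'd \<Rightarrow> real) \<Rightarrow> int ^ 'd \<Rightarrow> real" where
  "lattice_hit \<equiv> hit lattice_adj (2 * CARD('d))"

definition second_moment :: "int ^ 'd \<Rightarrow> int ^ 'd \<Rightarrow> real" where
  "second_moment x y = (\<integral>m. m x * m y \<partial>Q)"

lemma prob_space_Q: "prob_space Q" and sets_Q: "sets Q = sets borel"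
  using weak by (auto simp: converges_weakly_def)

sublocale Q: prob_space Q
  by (rule prob_space_Q)

lemma weak_limit:
  assumes "continuous_on UNIV f" "\<And>m. \<bar>f m\<bar> \<le> (C :: real)"
  shows "(\<lambda>k. \<integral>m. f m \<partial>\<mu> k) \<longlonglongrightarrow> (\<integral>m. f m \<partial>Q)"
proof -
  have "bounded (range f)" using assms(2) by (auto simp: bounded_iff)
  then show ?thesis using weak assms(1) by (auto simp: converges_weakly_def)
qed

lemma continuous_on_coordinate [continuous_intros]: "continuous_on UNIV (\<lambda>m :: int ^ 'd \<Rightarrow> real. m v)"
  by simp

lemma coordinate_measurable: "(\<lambda>m. m v) \<in> borel_measurable Q"
  using borel_measurable_continuous_onI[OF continuous_on_coordinate[of v]]
  by (subst measurable_cong_sets[OF sets_Q refl])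

lemma eventually_torus_vertex_inj_on_stars:
  "\<forall>\<^sub>F k in sequentially. 3 \<le> k \<and> inj_on (torus_vertex k) (lattice.star x \<union> lattice.star y)"
  by (intro eventually_conj eventually_ge_at_top eventually_torus_vertex_inj_on) simp

lemma AE_nonneg: "AE m in Q. 0 \<le> m x"
proof -
  define f where "f m = max 0 (min (- m x) 1)" for m :: "int ^ 'd \<Rightarrow> real"
  have f: "continuous_on UNIV f" unfolding f_def by (intro continuous_intros)
  have bdd: "\<bar>f m\<bar> \<le> 1" "0 \<le> f m" for m by (auto simp: f_def)
  have lim: "(\<lambda>k. \<integral>m. f m \<partial>\<mu> k) \<longlonglongrightarrow> (\<integral>m. f m \<partial>Q)"
    by (rule weak_limit[OF f bdd(1)])
  have "\<forall>\<^sub>F k in sequentially. (\<integral>m. f m \<partial>\<mu> k) = 0"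
    using eventually_torus_vertex_inj_on_stars[of x x]
  proof eventually_elim
    case (elim k)
    have "AE m in \<mu> k. 0 \<le> m x"
      by (rule torus_stationary_moments(2)[OF _ torus_stat, where y = x]) (use elim in auto)
    then have "AE m in \<mu> k. f m = 0" by eventually_elim (simp add: f_def)
    then show ?case by (rule integral_eq_zero_AE)
  qed
  from LIMSEQ_unique[OF lim tendsto_eventually[OF this]] have "(\<integral>m. f m \<partial>Q) = 0" .
  moreover have fm: "f \<in> borel_measurable Q"
    using borel_measurable_continuous_onI[OF f] by (subst measurable_cong_sets[OF sets_Q refl])
  have "integrable Q f"
    using bdd fm by (intro Q.integrable_const_bound[where B = 1]) auto
  ultimately have "AE m in Q. f m = 0"
    using bdd by (subst (asm) integral_nonneg_eq_0_iff_AE) auto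
  then show ?thesis by eventually_elim (auto simp: f_def split: if_splits)
qed

lemma truncated_second_moment_le:
  assumes K: "0 \<le> K"
  shows "(\<integral>m. cutoff K (m x) * cutoff K (m y) \<partial>Q) \<le> lattice.stationary_moment x y"
proof (rule tendsto_upperbound)
  show "(\<lambda>k. \<integral>m. cutoff K (m x) * cutoff K (m y) \<partial>\<mu> k) \<longlonglongrightarrow> (\<integral>m. cutoff K (m x) * cutoff K (m y) \<partial>Q)"
    by (rule weak_limit[OF _ cutoff_product_le[OF K]]) (intro continuous_intros)
  show "\<forall>\<^sub>F k in sequentially. (\<integral>m. cutoff K (m x) * cutoff K (m y) \<partial>\<mu> k) \<le> lattice.stationary_moment x y"
    using eventually_torus_vertex_inj_on_stars[of x y] eventually_torus_vertex_inj_on_stars[of y x]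
  proof eventually_elim
    case (elim k)
    note M = torus_stationary_moments[OF _ torus_stat, where k = k]
    interpret \<mu>: prob_space "\<mu> k" by (rule M(1)[where x = x and y = y]) (use elim in auto)
    have nn_x: "AE m in \<mu> k. 0 \<le> m x" by (rule M(2)[where y = y]) (use elim in auto)
    have nn_y: "AE m in \<mu> k. 0 \<le> m y" by (rule M(2)[where y = x]) (use elim in auto)
    have "(\<integral>m. cutoff K (m x) * cutoff K (m y) \<partial>\<mu> k) \<le> (\<integral>m. m x * m y \<partial>\<mu> k)"
    proof (rule integral_mono_AE)
      show "integrable (\<mu> k) (\<lambda>m. m x * m y)" by (rule M(5)) (use elim in auto)
      have "(\<lambda>m. cutoff K (m x) * cutoff K (m y)) \<in> borel_measurable borel"
        by (intro borel_measurable_continuous_onI continuous_intros)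
      then show "integrable (\<mu> k) (\<lambda>m. cutoff K (m x) * cutoff K (m y))"
        using cutoff_product_le[OF K] by (intro \<mu>.integrable_const_bound[where B = "K * K"]) auto
      show "AE m in \<mu> k. cutoff K (m x) * cutoff K (m y) \<le> m x * m y"
        using nn_x nn_y
      proof eventually_elim
        case (elim m)
        then show ?case
          using cutoff_bounds(3)[of K "m x"] cutoff_bounds(3)[of K "m y"]
          by (intro mult_mono cutoff_bounds(1)) auto
      qed
    qed
    also have "\<dots> = lattice.stationary_moment x y" by (rule M(6)) (use elim in auto)
    finally show ?case .
  qed
qed simp

lemma cutoff_tendsto: "(\<lambda>n. cutoff (real n) a) \<longlonglongrightarrow> max 0 a"
proof (rule tendsto_eventually)
  show "\<forall>\<^sub>F n in sequentially. cutoff (real n) a = max 0 a"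
    using eventually_ge_at_top[of "nat \<lceil>a\<rceil>"]
  proof eventually_elim
    case (elim n)
    then have "a \<le> real n" by linarith
    then show ?case by (simp add: cutoff_def)
  qed
qed

text \<open>The truncated products have expectation at most the torus value, for every truncation level, and
  Fatou's lemma removes the truncation.\<close>

lemma second_moment_bound:
  shows integrable_product: "integrable Q (\<lambda>m. m x * m y)"
    and second_moment_le: "second_moment x y \<le> lattice.stationary_moment x y"
    and second_moment_nonneg: "0 \<le> second_moment x y"
proof -
  let ?u = "\<lambda>n m :: int ^ 'd \<Rightarrow> real. cutoff (real n) (m x) * cutoff (real n) (m y)"
  let ?C = "lattice.stationary_moment x y"
  note [measurable] = coordinate_measurable
  have C: "0 \<le> ?C" using lattice.stationary_moment_bounds(1)[of x y] by linarith
  have int_u: "integrable Q (?u n)" for n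
    using cutoff_product_le[of "real n"] by (intro Q.integrable_const_bound[where B = "real n * real n"]) auto
  have "(\<integral>\<^sup>+m. ennreal (m x * m y) \<partial>Q) = (\<integral>\<^sup>+m. liminf (\<lambda>n. ennreal (?u n m)) \<partial>Q)"
  proof (rule nn_integral_cong_AE)
    show "AE m in Q. ennreal (m x * m y) = liminf (\<lambda>n. ennreal (?u n m))"
      using AE_nonneg[of x] AE_nonneg[of y]
    proof eventually_elim
      case (elim m)
      have "(\<lambda>n. ennreal (?u n m)) \<longlonglongrightarrow> ennreal (max 0 (m x) * max 0 (m y))"
        by (intro tendsto_ennrealI tendsto_mult cutoff_tendsto)
      then show ?case using elim lim_imp_Liminf[OF sequentially_bot] by fastforce
    qed
  qed
  also have "\<dots> \<le> liminf (\<lambda>n. \<integral>\<^sup>+m. ennreal (?u n m) \<partial>Q)"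
    by (rule nn_integral_liminf) measurable
  also have "\<dots> \<le> ennreal ?C"
  proof (rule Liminf_le)
    have "(\<integral>\<^sup>+m. ennreal (?u n m) \<partial>Q) = ennreal (\<integral>m. ?u n m \<partial>Q)" for n
      using int_u by (intro nn_integral_eq_integral) (auto simp: cutoff_bounds(1))
    then show "\<forall>\<^sub>F n in sequentially. (\<integral>\<^sup>+m. ennreal (?u n m) \<partial>Q) \<le> ennreal ?C"
      using truncated_second_moment_le[of "real _" x y] by (simp add: ennreal_leI)
  qed simp
  finally have le: "(\<integral>\<^sup>+m. ennreal (m x * m y) \<partial>Q) \<le> ennreal ?C" .
  have nn: "AE m in Q. 0 \<le> m x * m y"
    using AE_nonneg[of x] AE_nonneg[of y] by eventually_elim simp
  show int: "integrable Q (\<lambda>m. m x * m y)"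
    using nn le by (intro integrableI_nonneg) (auto intro: order.strict_trans1)
  show "0 \<le> second_moment x y"
    unfolding second_moment_def using nn by (rule integral_nonneg_AE)
  have "ennreal (second_moment x y) \<le> ennreal ?C"
    using le nn_integral_eq_integral[OF int nn] by (simp add: second_moment_def)
  then show "second_moment x y \<le> ?C" using C by simp
qed

lemma integrable_coordinate: "integrable Q (\<lambda>m. m x)"
  using Q.square_integrable_imp_integrable[of "\<lambda>m. m x"] integrable_product[of x x] coordinate_measurable
  by (simp add: power2_eq_square)

text \<open>Bounded second moments give uniform integrability of the masses: the part of the mean above level
  \<open>K\<close> is at most the second moment divided by \<open>K\<close>.\<close>

lemma cutoff_defect_le:
  assumes "0 \<le> a" "0 < K"
  shows "a - a * a / K \<le> cutoff K a"
proof (cases "a \<le> K")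
  case True
  then have "cutoff K a = a" using assms by (intro cutoff_id) auto
  then show ?thesis using assms by simp
next
  case False
  then have "a * K \<le> a * a" using assms by (intro mult_left_mono) auto
  then have "a \<le> a * a / K" using assms by (simp add: field_simps)
  then show ?thesis using cutoff_bounds(1)[of K a] by linarith
qed

lemma mean_eq_1: "(\<integral>m. m x \<partial>Q) = 1"
proof -
  let ?I = "\<lambda>n. \<integral>m. cutoff (real n) (m x) \<partial>Q"
  note [measurable] = coordinate_measurable
  have "?I \<longlonglongrightarrow> (\<integral>m. m x \<partial>Q)"
  proof (rule integral_dominated_convergence)
    show "integrable Q (\<lambda>m. \<bar>m x\<bar>)" using integrable_coordinate by auto
    show "AE m in Q. (\<lambda>n. cutoff (real n) (m x)) \<longlonglongrightarrow> m x"
      using AE_nonneg[of x]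
    proof eventually_elim
      case (elim m)
      then show ?case using cutoff_tendsto[of "m x"] by (simp add: max_def)
    qed
    show "AE m in Q. norm (cutoff (real n) (m x)) \<le> \<bar>m x\<bar>" for n
      using cutoff_bounds by simp
  qed measurable
  moreover have "1 - 2 / real n \<le> ?I n \<and> ?I n \<le> 1" if n: "0 < n" for n
  proof -
    let ?K = "real n"
    have lim: "(\<lambda>k. \<integral>m. cutoff ?K (m x) \<partial>\<mu> k) \<longlonglongrightarrow> ?I n"
      using cutoff_bounds[of ?K] by (intro weak_limit[where C = ?K] continuous_intros) auto
    have ev: "\<forall>\<^sub>F k in sequentially. 1 - 2 / ?K \<le> (\<integral>m. cutoff ?K (m x) \<partial>\<mu> k) \<and> (\<integral>m. cutoff ?K (m x) \<partial>\<mu> k) \<le> 1"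
      using eventually_torus_vertex_inj_on_stars[of x x]
    proof eventually_elim
      case (elim k)
      note M = torus_stationary_moments[OF _ torus_stat, where k = k and x = x and y = x]
      interpret \<mu>: prob_space "\<mu> k" by (rule M(1)) (use elim in auto)
      have nn: "AE m in \<mu> k. 0 \<le> m x" by (rule M(2)) (use elim in auto)
      have i1: "integrable (\<mu> k) (\<lambda>m. m x)" and i2: "integrable (\<mu> k) (\<lambda>m. m x * m x)"
        by (rule M(3), use elim in auto) (rule M(5), use elim in auto)
      have e1: "(\<integral>m. m x \<partial>\<mu> k) = 1" and e2: "(\<integral>m. m x * m x \<partial>\<mu> k) = 2"
        using M(4,6) elim by (auto simp: lattice.stationary_moment_def lap_def)
      have "(\<lambda>m. cutoff ?K (m x)) \<in> borel_measurable borel"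
        by (intro borel_measurable_continuous_onI continuous_intros)
      then have ic: "integrable (\<mu> k) (\<lambda>m. cutoff ?K (m x))"
        using cutoff_bounds[of ?K] by (intro \<mu>.integrable_const_bound[where B = ?K]) auto
      have "(\<integral>m. m x - m x * m x / ?K \<partial>\<mu> k) \<le> (\<integral>m. cutoff ?K (m x) \<partial>\<mu> k)"
        using nn n i1 i2 ic by (intro integral_mono_AE) (auto elim!: eventually_mono intro!: cutoff_defect_le)
      moreover have "(\<integral>m. cutoff ?K (m x) \<partial>\<mu> k) \<le> (\<integral>m. m x \<partial>\<mu> k)"
      proof (rule integral_mono_AE[OF ic i1])
        show "AE m in \<mu> k. cutoff ?K (m x) \<le> m x"
          using nn by eventually_elim (metis abs_of_nonneg cutoff_bounds(3))
      qed
      ultimately show ?case using i1 i2 e1 e2 by simp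
    qed
    show ?thesis
      using tendsto_lowerbound[OF lim eventually_mono[OF ev]] tendsto_upperbound[OF lim eventually_mono[OF ev]] by auto
  qed
  then have sandwich: "\<forall>\<^sub>F n in sequentially. 1 - 2 / real n \<le> ?I n" "\<forall>\<^sub>F n in sequentially. ?I n \<le> 1"
    by (auto intro: eventually_mono[OF eventually_gt_at_top[of 0]])
  have "(\<lambda>n. 1 - 2 / real n) \<longlonglongrightarrow> 1"
    using tendsto_diff[OF tendsto_const[of 1] lim_const_over_n[of 2]] by simp
  with sandwich have "?I \<longlonglongrightarrow> 1"
    by (rule tendsto_sandwich[OF _ _ _ tendsto_const])
  ultimately show ?thesis by (rule LIMSEQ_unique)
qed

text \<open>For fixed \<open>K\<close> the integrand is a bounded continuous function of finitely many coordinates, so the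
  stationarity of the torus laws passes to the weak limit.\<close>

lemma truncated_balance:
  assumes K: "0 \<le> K"
  shows "(\<Sum>v\<in>lattice.star x \<union> lattice.star y.
     \<integral>m. cutoff K (lattice_hit v m x) * cutoff K (lattice_hit v m y) - cutoff K (m x) * cutoff K (m y) \<partial>Q) = 0"
proof -
  let ?g = "\<lambda>v m. cutoff K (lattice_hit v m x) * cutoff K (lattice_hit v m y) - cutoff K (m x) * cutoff K (m y)"
  let ?F = "lattice.star x \<union> lattice.star y"
  have lim: "(\<lambda>k. \<Sum>v\<in>?F. \<integral>m. ?g v m \<partial>\<mu> k) \<longlonglongrightarrow> (\<Sum>v\<in>?F. \<integral>m. ?g v m \<partial>Q)"
  proof (intro tendsto_sum weak_limit)
    fix v
    show "continuous_on UNIV (?g v)"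
      unfolding hit_def by (intro continuous_intros)
    show "\<bar>?g v m\<bar> \<le> 2 * (K * K)" for m
      using cutoff_product_le[OF K, of "lattice_hit v m x" "lattice_hit v m y"]
        cutoff_product_le[OF K, of "m x" "m y"] by linarith
  qed
  have "\<forall>\<^sub>F k in sequentially. (\<Sum>v\<in>?F. \<integral>m. ?g v m \<partial>\<mu> k) = 0"
    using eventually_torus_vertex_inj_on_stars[of x y]
  proof eventually_elim
    case (elim k)
    show ?case by (rule torus_stationary_moments(7)[OF _ torus_stat]) (use elim K in auto)
  qed
  from LIMSEQ_unique[OF lim tendsto_eventually[OF this]] show ?thesis .
qed

lemma balanced_second_moment: "lattice.balanced second_moment"
  unfolding lattice.balanced_def
proof safe
  fix x y :: "int ^ 'd"
  let ?F = "lattice.star x \<union> lattice.star y"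
  note [measurable] = coordinate_measurable
  have conv: "(\<lambda>n. \<integral>m. cutoff (real n) (lattice_hit v m x) * cutoff (real n) (lattice_hit v m y)
        - cutoff (real n) (m x) * cutoff (real n) (m y) \<partial>Q)
      \<longlonglongrightarrow> (\<integral>m. lattice_hit v m x * lattice_hit v m y - m x * m y \<partial>Q)" for v
  proof (rule integral_dominated_convergence)
    have [measurable]: "(\<lambda>m. lattice_hit v m u) \<in> borel_measurable Q" for u
      unfolding hit_def by measurable
    have "integrable Q (\<lambda>m. lattice_hit v m x * lattice_hit v m y)"
    proof -
      have "lattice_hit v m x * lattice_hit v m y = m x * m y + lattice.drift (\<lambda>a b. m a * m b) x y v" for m
        using lattice.hit_product_diff[of v m x y] by simp
      then show ?thesis using integrable_product by (simp add: lattice.drift_def)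
    qed
    then show "integrable Q (\<lambda>m. \<bar>lattice_hit v m x * lattice_hit v m y\<bar> + \<bar>m x * m y\<bar>)"
      using integrable_product by auto
    show "(\<lambda>m. cutoff (real n) (lattice_hit v m x) * cutoff (real n) (lattice_hit v m y)
        - cutoff (real n) (m x) * cutoff (real n) (m y)) \<in> borel_measurable Q" for n
      by measurable
    show "(\<lambda>m. lattice_hit v m x * lattice_hit v m y - m x * m y) \<in> borel_measurable Q"
      by measurable
    have bound: "\<bar>cutoff K a * cutoff K b\<bar> \<le> \<bar>a * b\<bar>" for K a b
      using cutoff_bounds(1,3)[of K] by (simp add: abs_mult mult_mono)
    show "AE m in Q. norm (cutoff (real n) (lattice_hit v m x) * cutoff (real n) (lattice_hit v m y)
        - cutoff (real n) (m x) * cutoff (real n) (m y))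
        \<le> \<bar>lattice_hit v m x * lattice_hit v m y\<bar> + \<bar>m x * m y\<bar>" for n
    proof (rule AE_I2)
      fix m
      show "norm (cutoff (real n) (lattice_hit v m x) * cutoff (real n) (lattice_hit v m y)
        - cutoff (real n) (m x) * cutoff (real n) (m y))
        \<le> \<bar>lattice_hit v m x * lattice_hit v m y\<bar> + \<bar>m x * m y\<bar>"
        using bound[of "real n" "lattice_hit v m x" "lattice_hit v m y"] bound[of "real n" "m x" "m y"]
        by (auto intro: order_trans[OF abs_triangle_ineq4])
    qed
    show "AE m in Q. (\<lambda>n. cutoff (real n) (lattice_hit v m x) * cutoff (real n) (lattice_hit v m y)
        - cutoff (real n) (m x) * cutoff (real n) (m y))
      \<longlonglongrightarrow> lattice_hit v m x * lattice_hit v m y - m x * m y"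
      using AE_nonneg[of x] AE_nonneg[of y] AE_nonneg[of v]
    proof eventually_elim
      case (elim m)
      have lim: "(\<lambda>n. cutoff (real n) a) \<longlonglongrightarrow> a" if "0 \<le> a" for a
        using cutoff_tendsto[of a] that by (simp add: max_def)
      show ?case
        using elim by (intro tendsto_diff tendsto_mult lim lattice.hit_bounds(1)) auto
    qed
  qed
  have "(\<lambda>n. \<Sum>v\<in>?F. \<integral>m. cutoff (real n) (lattice_hit v m x) * cutoff (real n) (lattice_hit v m y)
        - cutoff (real n) (m x) * cutoff (real n) (m y) \<partial>Q)
      \<longlonglongrightarrow> (\<Sum>v\<in>?F. \<integral>m. lattice_hit v m x * lattice_hit v m y - m x * m y \<partial>Q)"
    by (rule tendsto_sum[OF conv])
  then have "(\<Sum>v\<in>?F. \<integral>m. lattice_hit v m x * lattice_hit v m y - m x * m y \<partial>Q) = 0"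
    unfolding truncated_balance[OF of_nat_0_le_iff] by (simp add: LIMSEQ_const_iff)
  moreover have "(\<integral>m. lattice_hit v m x * lattice_hit v m y - m x * m y \<partial>Q) = lattice.drift second_moment x y v" for v
    using integrable_product by (simp add: lattice.hit_product_diff lattice.drift_def second_moment_def)
  ultimately show "(\<Sum>v\<in>?F. lattice.drift second_moment x y v) = 0" by simp
qed

end

section \<open>Uniqueness of the balanced second moments on the lattice\<close>

text \<open>The two points run away from each other along a coordinate axis, so they do not meet after the start and each step
  falls under the first bound of \<open>balanced_nonneg_bounds\<close>; the constant depends only on the number
  of steps, not on the starting pair.\<close>

lemma lattice_ray_spread:
  fixes g :: "int ^ 'd \<Rightarrow> int ^ 'd \<Rightarrow> real"
  assumes bal: "lattice.balanced g" and nonneg: "\<And>x y. 0 \<le> g x y"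
    and symm: "\<And>x y. g x y = g y x" and le: "y $ i \<le> x $ i"
  shows "g (x + int j *s axis i 1) (y - int l *s axis i 1) \<le> (4 * real CARD('d)) ^ (j + l) * g x y"
proof -
  let ?C = "4 * real CARD('d)"
  have ray: "(z + int j *s axis i 1) $ i = z $ i + int j" "(z - int j *s axis i 1) $ i = z $ i - int j"
    for z :: "int ^ 'd" and j by (simp_all add: axis_nth_if)
  have step: "g u b \<le> ?C * g a b" if "lattice_adj a u" "u \<noteq> b" for a b u
    using lattice.balanced_nonneg_bounds(1)[OF bal, of a b u] nonneg that by simp
  have up: "g (x + int j *s axis i 1) y \<le> ?C ^ j * g x y" for j
  proof (induction j)
    case (Suc j)
    let ?a = "x + int j *s axis i 1" and ?u = "x + int (Suc j) *s axis i 1"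
    have "?u = ?a + axis i 1" by (simp add: vec_eq_iff axis_nth_if algebra_simps)
    then have "lattice_adj ?a ?u" by (simp only: lattice_adj_step)
    moreover have "?u $ i \<noteq> y $ i" using ray(1)[of x "Suc j"] le by linarith
    then have "?u \<noteq> y" by auto
    ultimately have "g ?u y \<le> ?C * g ?a y" by (rule step)
    also have "\<dots> \<le> ?C * (?C ^ j * g x y)" by (intro mult_left_mono Suc) simp
    finally show ?case by simp
  qed simp
  show ?thesis
  proof (induction l)
    case 0
    then show ?case using up[of j] by simp
  next
    case (Suc l)
    let ?x = "x + int j *s axis i 1"
    let ?b = "y - int l *s axis i 1" and ?u = "y - int (Suc l) *s axis i 1"
    have "?u = ?b - axis i 1" by (simp add: vec_eq_iff axis_nth_if algebra_simps)
    then have "lattice_adj ?b ?u" by (simp only: lattice_adj_step)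
    moreover have "?u $ i \<noteq> ?x $ i" using ray(1)[of x j] ray(2)[of y "Suc l"] le by linarith
    then have "?u \<noteq> ?x" by metis
    ultimately have "g ?x ?u \<le> ?C * g ?x ?b" using step[of ?b ?u ?x] symm by metis
    also have "\<dots> \<le> ?C * (?C ^ (j + l) * g x y)" by (intro mult_left_mono Suc) simp
    finally show ?case by simp
  qed
qed

text \<open>The supremum \<open>S\<close> of the relative defect need not be attained, so the minimum principle is used
  quantitatively: \<open>S * stationary_moment - e\<close> is small at some pair, hence small on \<open>B \<times> B'\<close> for two
  segments of \<open>n\<close> points starting there. Summing over \<open>B \<times> B'\<close>, where \<open>stationary_moment\<close> adds up to at
  least \<open>n\<^sup>2 / 2\<close> and \<open>e\<close> to at most \<open>2 * n\<close>, bounds \<open>S\<close> by \<open>4 / n\<close>.\<close>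

lemma lattice_balanced_unique:
  fixes c :: "int ^ 'd \<Rightarrow> int ^ 'd \<Rightarrow> real"
  assumes bal: "lattice.balanced c" and symm: "\<And>x y. c x y = c y x"
    and nonneg: "\<And>x y. 0 \<le> c x y" and upper: "\<And>x y. c x y \<le> lattice.stationary_moment x y"
    and lower: "\<And>B B' n. finite B \<Longrightarrow> finite B' \<Longrightarrow> card B = n \<Longrightarrow> card B' = n \<Longrightarrow>
      real n * real n - real n \<le> (\<Sum>x\<in>B. \<Sum>y\<in>B'. c x y)"
  shows "c x y = lattice.stationary_moment x y"
proof -
  let ?c0 = "lattice.stationary_moment :: int ^ 'd \<Rightarrow> _"
  have pos: "0 < ?c0 u v" for u v using lattice.stationary_moment_bounds(1)[of u v] by linarith
  define e where "e u v = ?c0 u v - c u v" for u v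
  define h where "h p = e (fst p) (snd p) / ?c0 (fst p) (snd p)" for p
  define S where "S = (SUP p. h p)"
  have h: "0 \<le> h p" "h p \<le> 1" for p
    using pos[of "fst p" "snd p"] upper[of "fst p" "snd p"] nonneg[of "fst p" "snd p"]
    by (simp_all add: h_def e_def)
  have h_le_S: "h p \<le> S" for p
    unfolding S_def using h by (intro cSUP_upper bdd_aboveI[of _ 1]) auto
  have S0: "0 \<le> S" using h(1) h_le_S order_trans by blast
  define g where "g u v = S * ?c0 u v - e u v" for u v
  have "lattice.balanced e"
    using lattice.balanced_diff_scaled[OF lattice.balanced_stationary_moment bal, of 1] by (simp add: e_def[abs_def])
  then have g_bal: "lattice.balanced g"
    unfolding g_def by (intro lattice.balanced_diff_scaled lattice.balanced_stationary_moment)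
  have c0_sym: "?c0 u v = ?c0 v u" for u v by (simp add: lattice.stationary_moment_def lattice.lap_sym)
  have g_sym: "g u v = g v u" for u v using symm[of u v] c0_sym[of u v] by (simp add: g_def e_def)
  have g_nonneg: "0 \<le> g u v" for u v
    using h_le_S[of "(u, v)"] pos[of u v] by (simp add: g_def h_def field_simps)
  obtain i :: 'd where True by simp
  let ?C = "4 * real CARD('d)"
  have "1 \<le> CARD('d)" by (simp add: Suc_le_eq)
  then have C: "1 \<le> ?C" by linarith
  have main: "S * real n \<le> 4" if n: "0 < n" for n
  proof -
    let ?n = "real n"
    \<comment> \<open>The sum over \<open>B \<times> B'\<close> of the bound that at most \<open>n + n\<close> steps give for a starting value \<open>2 * \<epsilon>\<close> is \<open>T * \<epsilon>\<close>.\<close>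
    define T where "T = ?n * ?n * ?C ^ (n + n) * 2"
    have T: "0 < T" using n C by (simp add: T_def)
    have "S * ?n * ?n / 2 \<le> 2 * ?n + \<delta>" if d: "0 < \<delta>" for \<delta>
    proof -
      define \<epsilon> where "\<epsilon> = \<delta> / T"
      have eps: "0 < \<epsilon>" using d T by (simp add: \<epsilon>_def)
      have "\<exists>p. S - \<epsilon> < h p"
      proof (rule ccontr)
        assume "\<not> ?thesis"
        then have "S \<le> S - \<epsilon>" unfolding S_def by (intro cSUP_least) (auto simp: not_less)
        with eps show False by simp
      qed
      then obtain a b where ab: "S - \<epsilon> < h (a, b)" by auto
      have g_ab: "g a b \<le> 2 * \<epsilon>"
      proof -
        have "g a b = (S - h (a, b)) * ?c0 a b" using pos[of a b] by (simp add: g_def h_def field_simps)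
        also have "\<dots> \<le> \<epsilon> * 2"
          using ab lattice.stationary_moment_bounds(2)[of a b] pos[of a b] eps
          by (intro mult_mono) (auto simp: of_bool_def split: if_splits)
        finally show ?thesis by simp
      qed
      \<comment> \<open>The segments must point away from each other; swap the points if necessary.\<close>
      obtain x y where xy: "y $ i \<le> x $ i" "g x y \<le> 2 * \<epsilon>"
        using g_ab g_sym[of a b] by (metis linear)
      define B where "B = (\<lambda>j. x + int j *s axis i 1) ` {..<n}"
      define B' where "B' = (\<lambda>j. y - int j *s axis i 1) ` {..<n}"
      have "inj_on (\<lambda>j. x + int j *s axis i 1) {..<n}" "inj_on (\<lambda>j. y - int j *s axis i 1) {..<n}"
        by (auto simp: inj_on_def vec_eq_iff axis_nth_if split: if_splits)
      then have card: "card B = n" "card B' = n" and fin: "finite B" "finite B'"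
        by (auto simp: B_def B'_def card_image)
      have g_le: "g u v \<le> ?C ^ (n + n) * (2 * \<epsilon>)" if "u \<in> B" "v \<in> B'" for u v
      proof -
        obtain j where j: "u = x + int j *s axis i 1" "j < n" using \<open>u \<in> B\<close> unfolding B_def by blast
        obtain l where l: "v = y - int l *s axis i 1" "l < n" using \<open>v \<in> B'\<close> unfolding B'_def by blast
                have "g u v \<le> ?C ^ (j + l) * g x y"
          unfolding j l by (rule lattice_ray_spread[OF g_bal g_nonneg g_sym xy(1)])
        also have "\<dots> \<le> ?C ^ (n + n) * (2 * \<epsilon>)"
          using C j l xy(2) g_nonneg[of x y] by (intro mult_mono power_increasing) auto
        finally show ?thesis .
      qed
      have sum_c0: "(\<Sum>u\<in>B. \<Sum>v\<in>B'. ?c0 u v) \<le> ?n * ?n + ?n"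
      proof -
        have "(\<Sum>v\<in>B'. ?c0 u v) \<le> ?n + 1" for u
        proof -
          have "(\<Sum>v\<in>B'. ?c0 u v) \<le> (\<Sum>v\<in>B'. 1 + of_bool (u = v))"
            by (intro sum_mono lattice.stationary_moment_bounds(2))
          also have "\<dots> = ?n + (\<Sum>v\<in>B'. if u = v then 1 else 0)"
            using card by (simp add: sum.distrib of_bool_def)
          also have "\<dots> \<le> ?n + 1" using fin by (simp add: sum.delta)
          finally show ?thesis .
        qed
        then have "(\<Sum>u\<in>B. \<Sum>v\<in>B'. ?c0 u v) \<le> (\<Sum>u\<in>B. ?n + 1)" by (rule sum_mono)
        then show ?thesis using card by (simp add: algebra_simps)
      qed
      have "?n * ?n / 2 = (\<Sum>u\<in>B. \<Sum>v\<in>B'. 1 / 2)" using card by simp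
      also have "\<dots> \<le> (\<Sum>u\<in>B. \<Sum>v\<in>B'. ?c0 u v)"
        by (intro sum_mono lattice.stationary_moment_bounds(1))
      finally have "S * (?n * ?n / 2) \<le> S * (\<Sum>u\<in>B. \<Sum>v\<in>B'. ?c0 u v)"
        using S0 by (rule mult_left_mono)
      also have "\<dots> = (\<Sum>u\<in>B. \<Sum>v\<in>B'. g u v) + (\<Sum>u\<in>B. \<Sum>v\<in>B'. e u v)"
        by (simp add: g_def sum.distrib[symmetric] sum_distrib_left)
      also have "(\<Sum>u\<in>B. \<Sum>v\<in>B'. e u v) = (\<Sum>u\<in>B. \<Sum>v\<in>B'. ?c0 u v) - (\<Sum>u\<in>B. \<Sum>v\<in>B'. c u v)"
        by (simp add: e_def sum_subtractf)
      also have "(\<Sum>u\<in>B. \<Sum>v\<in>B'. g u v) \<le> (\<Sum>u\<in>B. \<Sum>v\<in>B'. ?C ^ (n + n) * (2 * \<epsilon>))"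
        by (intro sum_mono g_le)
      also have "\<dots> = T * \<epsilon>" using card by (simp add: T_def)
      also have "\<dots> = \<delta>" using T by (simp add: \<epsilon>_def)
      finally have "S * (?n * ?n / 2) \<le> \<delta> + ((\<Sum>u\<in>B. \<Sum>v\<in>B'. ?c0 u v) - (\<Sum>u\<in>B. \<Sum>v\<in>B'. c u v))"
        by simp
      then show ?thesis
        using sum_c0 lower[OF fin card] by (simp add: algebra_simps)
    qed
    then have "S * ?n * ?n / 2 \<le> 2 * ?n" by (rule field_le_epsilon)
    then have "?n * (S * ?n) \<le> ?n * 4" by (simp add: algebra_simps)
    then show ?thesis using n by simp
  qed
  have "S \<le> 0"
  proof (rule ccontr)
    assume "\<not> S \<le> 0"
    then obtain n :: nat where "4 < real n * S" using reals_Archimedean3[of S] by auto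
    with main[of n] show False by (cases "n = 0") (auto simp: mult.commute)
  qed
  with h[of "(x, y)"] h_le_S[of "(x, y)"] have "h (x, y) = 0" by linarith
  then show ?thesis using pos[of x y] by (simp add: h_def e_def)
qed



section \<open>Moments of the limiting distribution\<close>

context torus_limit
begin

text \<open>The masses \<open>X B\<close> and \<open>X B'\<close> have mean \<open>n\<close> and variance at most \<open>n\<close>, and the square of
  \<open>X B + X B' - 2 * n\<close> has nonnegative expectation.\<close>

lemma product_of_masses_lower_bound:
  assumes B: "finite B" "finite B'" "card B = n" "card B' = n"
  shows "real n * real n - real n \<le> (\<Sum>x\<in>B. \<Sum>y\<in>B'. second_moment x y)"
proof -
  let ?n = "real n"
  define X where "X B m = (\<Sum>x\<in>B. m x)" for B and m :: "int ^ 'd \<Rightarrow> real"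
  have prod: "X B m * X B' m = (\<Sum>x\<in>B. \<Sum>y\<in>B'. m x * m y)" for B B' m
    by (simp add: X_def sum_product)
  have int_XX: "integrable Q (\<lambda>m. X B m * X B' m)" for B B'
    unfolding prod by (intro Bochner_Integration.integrable_sum integrable_product)
  have E_XX: "(\<integral>m. X B m * X B' m \<partial>Q) = (\<Sum>x\<in>B. \<Sum>y\<in>B'. second_moment x y)" for B B'
    unfolding prod second_moment_def
    by (simp add: Bochner_Integration.integral_sum Bochner_Integration.integrable_sum integrable_product)
  have int_X: "integrable Q (X B)" for B
    unfolding X_def by (intro Bochner_Integration.integrable_sum integrable_coordinate)
  have E_X: "(\<integral>m. X B m \<partial>Q) = real (card B)" for B
    unfolding X_def by (simp add: Bochner_Integration.integral_sum integrable_coordinate mean_eq_1)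
  have square: "(\<integral>m. X A m * X A m \<partial>Q) \<le> ?n * ?n + ?n" if A: "finite A" "card A = n" for A
  proof -
    have row: "(\<Sum>y\<in>A. second_moment x y) \<le> ?n + 1" for x
    proof -
      have "(\<Sum>y\<in>A. second_moment x y) \<le> (\<Sum>y\<in>A. 1 + of_bool (x = y))"
        by (intro sum_mono order_trans[OF second_moment_le lattice.stationary_moment_bounds(2)])
      also have "\<dots> = ?n + (\<Sum>y\<in>A. if x = y then 1 else 0)"
        using A by (simp add: sum.distrib of_bool_def)
      also have "\<dots> \<le> ?n + 1" using A by (simp add: sum.delta)
      finally show ?thesis .
    qed
    have "(\<Sum>x\<in>A. \<Sum>y\<in>A. second_moment x y) \<le> (\<Sum>x\<in>A. ?n + 1)" by (rule sum_mono[OF row])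
    then show ?thesis using A by (simp add: E_XX algebra_simps)
  qed
  have "0 \<le> (\<integral>m. (X B m + X B' m - 2 * ?n)\<^sup>2 \<partial>Q)" by simp
  also have "\<dots> = (\<integral>m. X B m * X B m + X B' m * X B' m + 2 * (X B m * X B' m)
      - 4 * ?n * X B m - 4 * ?n * X B' m + 4 * ?n * ?n \<partial>Q)"
    by (simp add: power2_eq_square algebra_simps)
  also have "\<dots> = (\<integral>m. X B m * X B m \<partial>Q) + (\<integral>m. X B' m * X B' m \<partial>Q) + 2 * (\<integral>m. X B m * X B' m \<partial>Q)
      - 4 * ?n * ?n - 4 * ?n * ?n + 4 * ?n * ?n"
    using B by (simp add: int_XX int_X E_X Q.prob_space)
  also have "\<dots> \<le> 2 * (?n * ?n + ?n) + 2 * (\<integral>m. X B m * X B' m \<partial>Q) - 4 * ?n * ?n"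
    using square[of B] square[of B'] B by simp
  finally show ?thesis by (simp add: E_XX)
qed

lemma second_moment_eq: "second_moment x y = lattice.stationary_moment x y"
proof (rule lattice_balanced_unique)
  show "second_moment x y = second_moment y x" for x y
    by (simp add: second_moment_def mult.commute)
qed (rule balanced_second_moment second_moment_nonneg second_moment_le product_of_masses_lower_bound; assumption?)+

end

theorem theorem3p4:
  fixes Q :: "(int ^ 'd \<Rightarrow> real) measure"
    and P :: "'w measure"
    and N :: "int ^ 'd \<Rightarrow> real \<Rightarrow> 'w \<Rightarrow> nat"
    and M :: "real \<Rightarrow> int ^ 'd \<Rightarrow> 'w \<Rightarrow> real"
  assumes "is_Q_infinity Q"
    and "meteor_process P UNIV lattice_adj N M"
    and "law_at P UNIV M 0 = Q"
  shows "(\<forall>x. integrable P (M 0 x) \<and> integrable P (\<lambda>\<omega>. (M 0 x \<omega>)\<^sup>2)) \<and>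
         (\<forall>x. prob_space.expectation P (M 0 x) = 1) \<and>
         (\<forall>x. prob_space.variance P (M 0 x) = 1) \<and>
         (\<forall>x y. lattice_adj x y \<longrightarrow>
            prob_space.covariance P (M 0 x) (M 0 y) = - (1 / (2 * real CARD('d)))) \<and>
         (\<forall>x y. x \<noteq> y \<longrightarrow> \<not> lattice_adj x y \<longrightarrow>
            prob_space.covariance P (M 0 x) (M 0 y) = 0)"
proof -
  obtain Qk where Qk: "\<forall>k\<ge>3. torus_stationary k (Qk k)"
    "converges_weakly (\<lambda>k. distr (Qk k) borel (periodic_extension k)) Q"
    using assms(1) unfolding is_Q_infinity_def by blast
  interpret torus_limit Qk Q
    by unfold_locales (use Qk in auto)
  interpret P: prob_space P using assms(2) by (simp add: meteor_process_def)
  have meas [measurable]: "M 0 x \<in> borel_measurable P" for x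
    using assms(2) by (simp add: meteor_process_def)
  let ?B = "PiM UNIV (\<lambda>_. borel) :: (int ^ 'd \<Rightarrow> real) measure"
  have X: "(\<lambda>\<omega>. \<lambda>v\<in>UNIV. M 0 v \<omega>) \<in> measurable P ?B"
    by (intro measurable_restrict meas)
  have Q: "Q = distr P ?B (\<lambda>\<omega>. \<lambda>v\<in>UNIV. M 0 v \<omega>)"
    using assms(3) by (simp add: law_at_def)
  have coord: "(\<lambda>m. m x) \<in> borel_measurable ?B" for x by measurable
  have coord2: "(\<lambda>m. m x * m y) \<in> borel_measurable ?B" for x y
    by (intro borel_measurable_times coord)
  have int1: "integrable P (M 0 x)" and E1: "P.expectation (M 0 x) = 1" for x
    using integrable_coordinate[of x] mean_eq_1[of x]
    unfolding Q integrable_distr_eq[OF X coord] integral_distr[OF X coord] by simp_all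
  have int2: "integrable P (\<lambda>\<omega>. M 0 x \<omega> * M 0 y \<omega>)"
    and E2: "P.expectation (\<lambda>\<omega>. M 0 x \<omega> * M 0 y \<omega>) = lattice.stationary_moment x y" for x y
    using integrable_product[of x y] second_moment_eq[of x y, unfolded second_moment_def]
    unfolding Q integrable_distr_eq[OF X coord2] integral_distr[OF X coord2] by simp_all
  have cov: "P.covariance (M 0 x) (M 0 y) = - lap lattice_adj (2 * CARD('d)) x y" for x y
  proof -
    have "P.covariance (M 0 x) (M 0 y) = P.expectation (\<lambda>\<omega>. M 0 x \<omega> * M 0 y \<omega> - M 0 x \<omega> - M 0 y \<omega> + 1)"
      unfolding P.covariance_def E1 by (simp add: algebra_simps)
    also have "\<dots> = lattice.stationary_moment x y - 1"
      by (simp add: int1 int2 E1 E2 P.prob_space)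
    finally show ?thesis by (simp add: lattice.stationary_moment_def)
  qed
  have "P.variance (M 0 x) = P.covariance (M 0 x) (M 0 x)" for x
    unfolding P.covariance_def by (simp add: power2_eq_square)
  then have "P.variance (M 0 x) = 1" for x
    by (simp add: cov lap_def)
  moreover have "P.covariance (M 0 x) (M 0 y) = - (1 / (2 * real CARD('d)))" if "lattice_adj x y" for x y
    using that lattice.irrefl by (auto simp: cov lap_def)
  moreover have "P.covariance (M 0 x) (M 0 y) = 0" if "x \<noteq> y" "\<not> lattice_adj x y" for x y
    using that by (auto simp: cov lap_def)
  ultimately show ?thesis
    using int1 int2 E1 by (auto simp: power2_eq_square)
qed

end
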